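(* Let $f,r,\mathrm{B},\mathrm{D},\mathrm{d}$, $F,R,\mathbf{D},\mathbf{d},\mathcal{W}^*$, and the stochastic iteration with constant stepsize $\alpha_k\equiv\alpha$ be as in the context, let $\mathbf{J}=\mathbf{Q}-\alpha\mathbf{D}\mathbf{D}^{\top}$ and $(\mathbf{X}^*,\mathbf{\Lambda}^* )\in\mathcal{W}^*$. Assume there exist $c_1,c_2,c_4\ge0$, $c_3\in(0,1]$ and a random sequence $\{\sigma_k^2\}_{k\ge1}$ (of nonnegative numbers) such that for every $k\ge1$ $$\mathbb{E}\,\mathbf{g}^k=\nabla F(\mathbf{X}^k),\qquad \mathbb{E}\|\mathbf{g}^k-\nabla F(\mathbf{X}^* )\|^2\le2c_1D_F(\mathbf{X}^k,\mathbf{X}^* )+c_2\sigma_k^2,$$ $$\mathbb{E}\,\sigma_{k+1}^2\le(1-c_3)\sigma_k^2+2c_4D_F(\mathbf{X}^k,\mathbf{X}^* ).$$ Let $\kappa=c_2/c_3$ and, for an integer $K\ge1$, $\mathbf{X}_K=\frac1K\sum_{k=0}^{K-1}\mathbf{X}^{k+1}$ and $\tilde{\mathbf{X}}_K=\frac1K\sum_{k=0}^{K-1}\bar{\mathbf{X}}^{k+1}$. If $\alpha\in\big(0,\frac{1}{2(c_1+\kappa c_4)}\big)$ and $\mathbf{J}\succ0$, then $$\mathbb{E}\big(D_F(\mathbf{X}_K,\mathbf{X}^* )+D_R(\tilde{\mathbf{X}}_K,\mathbf{X}^* )\big)\le\frac{\|\bar{\mathbf{X}}^0-(\alpha\mathbf{D}^{\top}\mathbf{\Lambda}^*+\mathbf{X}^*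 )\|^2+\|\mathbf{\Lambda}^*\|^2_{\alpha\mathbf{J}}+\kappa\alpha^2\sigma_1^2}{\alpha K}.$$
   Context: Problem: $\min_{\mathrm{x}\in\mathbb{R}^n} f(\mathrm{x})+r(\mathrm{B}\mathrm{x})+\delta_0(\mathrm{D}\mathrm{x}-\mathrm{d})$, where $\mathrm{B}\in\mathbb{R}^{p_1\times n}$, $\mathrm{D}\in\mathbb{R}^{p_2\times n}$, $\mathrm{d}\in\mathbb{R}^{p_2}$, and $\delta_0(z)=0$ if $z=0$, $+\infty$ otherwise. Standing assumptions: the solution set is nonempty; $f:\mathbb{R}^n\to\mathbb{R}$ is convex and differentiable with $L$-Lipschitz gradient ($L>0$), of finite-sum form $f=\sum_{i=1}^m f_i$; $r:\mathbb{R}^{p_1}\to(-\infty,+\infty]$ is proper, closed and convex. Reformulation: $\mathcal{X}=\mathbb{R}^{n+p_1}$, $\mathcal{Y}=\mathbb{R}^{p_2+p_1}$, $\mathcal{W}=\mathcal{X}\times\mathcal{Y}$; for $\mathbf{X}=(\mathrm{x},\mathrm{y})\in\mathcal{X}$ put $F(\mathbf{X})=f(\mathrm{x})$, $R(\mathbf{X})=r(\mathrm{y})$, $\mathbf{D}\mathbf{X}=(\mathrm{D}\mathrm{x},\mathrm{B}\mathrm{x}-\mathrm{y})\in\mathcal{Y}$, and $\mathbf{d}=(\mathrm{d},0)\in\mathcal{Y}$. $\mathcal{W}^*=\mathcal{X}^*\times\mathcal{Y}^*$ is the set of saddle points (min over $\mathbf{X}$, max over $\mathbf{\Lambda}$)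 of $\mathcal{L}(\mathbf{X},\mathbf{\Lambda})=F(\mathbf{X})+R(\mathbf{X})+\langle\mathbf{\Lambda},\mathbf{D}\mathbf{X}-\mathbf{d}\rangle$ on $\mathcal{W}$, where $\mathcal{X}^*$ is the set of minimizers of $F+R$ subject to $\mathbf{D}\mathbf{X}=\mathbf{d}$ and $\mathcal{Y}^*$ the set of dual optimal solutions. Strong duality is assumed: $\mathcal{W}^*\ne\emptyset$. Iteration: $\alpha>0$, $\mathbf{Q}$ is a self-adjoint linear operator on $\mathcal{Y}$; from $\mathbf{X}^0\in\mathcal{X}$ and $\mathbf{\Lambda}^0=0$, for $k\ge0$, \begin{align*} \bar{\mathbf{X}}^{k}&=\mathrm{prox}^{\alpha}_{R}\big(\mathbf{X}^{k}-\alpha(\mathbf{D}^{\top}\mathbf{\Lambda}^{k}+\mathbf{g}^{k})\big),\\ \mathbf{\Lambda}^{k+1}&=\arg\min_{\mathbf{\Lambda}\in\mathcal{Y}}\Big\{\tfrac12\|\mathbf{\Lambda}-\mathbf{\Lambda}^k\|^2_{\mathbf{Q}}+\langle\mathbf{\Lambda},\mathbf{d}-\mathbf{D}\bar{\mathbf{X}}^k\rangle\Big\},\\ \mathbf{X}^{k+1}&=\bar{\mathbf{X}}^{k}+\alpha\mathbf{D}^{\top}(\mathbf{\Lambda}^k-\mathbf{\Lambda}^{k+1}), \end{align*} where $\mathbf{g}^k=(g^k,0)\in\mathbb{R}^n\times\mathbb{R}^{p_1}$ is a random estimate of $\nabla F(\mathbf{X}^k)$. The expectations in the hypotheses on $\mathbf{g}^k$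 and $\sigma_{k+1}^2$ are conditional on the history of the algorithm before $\mathbf{g}^k$ is sampled (which determines $\mathbf{X}^k,\mathbf{\Lambda}^k,\sigma_k$). The initial data $\mathbf{X}^0,\mathbf{g}^0$ (hence $\bar{\mathbf{X}}^0,\mathbf{\Lambda}^1,\mathbf{X}^1$) and $\sigma_1^2$ are regarded as fixed, the expectation in the conclusion being over the randomness of steps $k\ge1$. Bregman divergences: $D_F(\mathbf{X},\mathbf{X}^* )=F(\mathbf{X})-F(\mathbf{X}^* )-\langle\nabla F(\mathbf{X}^* ),\mathbf{X}-\mathbf{X}^*\rangle$ and $D_R(\mathbf{X},\mathbf{X}^* )=R(\mathbf{X})-R(\mathbf{X}^* )-\langle\boldsymbol{\vartheta}^*,\mathbf{X}-\mathbf{X}^*\rangle$ with the subgradient $\boldsymbol{\vartheta}^*=-\nabla F(\mathbf{X}^* )-\mathbf{D}^{\top}\mathbf{\Lambda}^*\in\partial R(\mathbf{X}^* )$. For a self-adjoint $H$, $\|x\|_H^2=\langle x,Hx\rangle$, and $H\succ0$ means positive definite. $\mathrm{prox}^{\alpha}_{R}(\mathbf{Z})=\arg\min_{\mathbf{V}}\{R(\mathbf{V})+\frac{1}{2\alpha}\|\mathbf{V}-\mathbf{Z}\|^2\}$. *)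

theory Defs
  imports "HOL-Probability.Probability"
begin

definition ereal_epigraph :: "('a \<Rightarrow> ereal) \<Rightarrow> ('a \<times> real) set" where
  "ereal_epigraph r = {(y, t). r y \<le> ereal t}"

definition proper_closed_convex :: "('a::real_normed_vector \<Rightarrow> ereal) \<Rightarrow> bool" where
  "proper_closed_convex r \<longleftrightarrow>
     (\<forall>y. r y \<noteq> -\<infinity>) \<and> (\<exists>y. r y \<noteq> \<infinity>) \<and>
     closed (ereal_epigraph r) \<and> convex (ereal_epigraph r)"

definition indicator_zero :: "'a::zero \<Rightarrow> ereal" where
  "indicator_zero z = (if z = 0 then 0 else \<infinity>)"

text \<open>Solutions are required to have a finite objective value, so that an infeasible problem
  has no solution.\<close>

definition solution_set :: "('a \<Rightarrow> ereal) \<Rightarrow> 'a set" where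
  "solution_set h = {x. h x < \<infinity> \<and> (\<forall>z. h x \<le> h z)}"

definition problem_objective ::
  "(real^'n \<Rightarrow> real) \<Rightarrow> (real^'p1 \<Rightarrow> ereal) \<Rightarrow> real^'n^'p1 \<Rightarrow> real^'n^'p2 \<Rightarrow> real^'p2
    \<Rightarrow> real^'n \<Rightarrow> ereal" where
  "problem_objective f r B D d x = ereal (f x) + r (B *v x) + indicator_zero (D *v x - d)"

text \<open>The gradient is unique where \<open>h\<close> is differentiable; elsewhere the value is unspecified.\<close>

definition gradient :: "('a::real_inner \<Rightarrow> real) \<Rightarrow> 'a \<Rightarrow> 'a" where
  "gradient h x = (THE v. GDERIV h x :> v)"

definition lift_F :: "(real^'n \<Rightarrow> real) \<Rightarrow> (real^'n) \<times> (real^'p1) \<Rightarrow> real" where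
  "lift_F f X = f (fst X)"

definition lift_R :: "(real^'p1 \<Rightarrow> ereal) \<Rightarrow> (real^'n) \<times> (real^'p1) \<Rightarrow> ereal" where
  "lift_R r X = r (snd X)"

definition lift_D ::
  "real^'n^'p1 \<Rightarrow> real^'n^'p2 \<Rightarrow> (real^'n) \<times> (real^'p1) \<Rightarrow> (real^'p2) \<times> (real^'p1)" where
  "lift_D B D X = (D *v fst X, B *v fst X - snd X)"

definition lift_d :: "real^'p2 \<Rightarrow> (real^'p2) \<times> (real^'p1)" where
  "lift_d d = (d, 0)"

definition lagrangian ::
  "('a \<Rightarrow> real) \<Rightarrow> ('a \<Rightarrow> ereal) \<Rightarrow> ('a \<Rightarrow> 'b::real_inner) \<Rightarrow> 'b \<Rightarrow> 'a \<Rightarrow> 'b \<Rightarrow> ereal" where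
  "lagrangian F R A b X \<Lambda> = ereal (F X) + R X + ereal (\<Lambda> \<bullet> (A X - b))"

definition saddle_points :: "('a \<Rightarrow> 'b \<Rightarrow> ereal) \<Rightarrow> ('a \<times> 'b) set" where
  "saddle_points L = {(X, \<Lambda>). \<forall>X' \<Lambda>'. L X \<Lambda>' \<le> L X \<Lambda> \<and> L X \<Lambda> \<le> L X' \<Lambda>}"

definition self_adjoint :: "('b::real_inner \<Rightarrow> 'b) \<Rightarrow> bool" where
  "self_adjoint H \<longleftrightarrow> linear H \<and> (\<forall>x y. H x \<bullet> y = x \<bullet> H y)"

definition weighted_norm_sq :: "('b::real_inner \<Rightarrow> 'b) \<Rightarrow> 'b \<Rightarrow> real" where
  "weighted_norm_sq H x = x \<bullet> H x"

definition pos_def :: "('b::real_inner \<Rightarrow> 'b) \<Rightarrow> bool" where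
  "pos_def H \<longleftrightarrow> self_adjoint H \<and> (\<forall>x. x \<noteq> 0 \<longrightarrow> x \<bullet> H x > 0)"

definition prox :: "real \<Rightarrow> ('a::real_normed_vector \<Rightarrow> ereal) \<Rightarrow> 'a \<Rightarrow> 'a" where
  "prox \<alpha> R Z = (ARG_MIN (\<lambda>V. R V + ereal (1 / (2 * \<alpha>) * (norm (V - Z))\<^sup>2)) V. True)"

text \<open>One run of the method along a given sequence \<open>g\<close> of gradient estimates.\<close>

definition primal_dual_run ::
  "real \<Rightarrow> ('a::real_inner \<Rightarrow> ereal) \<Rightarrow> ('a \<Rightarrow> 'b::real_inner) \<Rightarrow> 'b \<Rightarrow> ('b \<Rightarrow> 'b)
    \<Rightarrow> (nat \<Rightarrow> 'a) \<Rightarrow> (nat \<Rightarrow> 'a) \<Rightarrow> (nat \<Rightarrow> 'a) \<Rightarrow> (nat \<Rightarrow> 'b) \<Rightarrow> bool" where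
  "primal_dual_run \<alpha> R A b Q g X Xbar \<Lambda> \<longleftrightarrow>
     \<Lambda> 0 = 0 \<and>
     (\<forall>k. Xbar k = prox \<alpha> R (X k - \<alpha> *\<^sub>R (adjoint A (\<Lambda> k) + g k)) \<and>
          \<Lambda> (Suc k) = (ARG_MIN (\<lambda>\<Theta>. 1 / 2 * weighted_norm_sq Q (\<Theta> - \<Lambda> k)
                                   + \<Theta> \<bullet> (b - A (Xbar k))) \<Theta>. True) \<and>
          X (Suc k) = Xbar k + \<alpha> *\<^sub>R adjoint A (\<Lambda> k - \<Lambda> (Suc k)))"

definition bregman :: "('a::real_inner \<Rightarrow> real) \<Rightarrow> 'a \<Rightarrow> 'a \<Rightarrow> real" where
  "bregman F X Y = F X - F Y - gradient F Y \<bullet> (X - Y)"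

text \<open>Bregman divergence of an extended-valued function with respect to a chosen vector \<open>\<theta>\<close>.
  It is nonnegative when \<open>R Y\<close> is finite and \<open>\<theta>\<close> is a subgradient of \<open>R\<close> at \<open>Y\<close>.\<close>

definition bregman_sub :: "('a::real_inner \<Rightarrow> ereal) \<Rightarrow> 'a \<Rightarrow> 'a \<Rightarrow> 'a \<Rightarrow> ereal" where
  "bregman_sub R \<theta> X Y = R X - R Y - ereal (\<theta> \<bullet> (X - Y))"

text \<open>Coordinatewise conditional expectation of a vector-valued random variable; as with
  \<^const>\<open>real_cond_exp\<close>, it is meaningful for integrable \<open>Z\<close>.\<close>

definition vec_cond_exp :: "'w measure \<Rightarrow> 'w measure \<Rightarrow> ('w \<Rightarrow> 'a::euclidean_space) \<Rightarrow> 'w \<Rightarrow> 'a" where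
  "vec_cond_exp M H Z \<omega> = (\<Sum>b\<in>Basis. real_cond_exp M H (\<lambda>\<omega>. Z \<omega> \<bullet> b) \<omega> *\<^sub>R b)"

end

theory Submission
  imports Defs
begin

text \<open>With \<open>g\<close>, \<open>\<theta>\<close>, \<open>\<lambda>\<close>, \<open>x\<close> and \<open>y\<close> denoting the deviations from the saddle point of the gradient
  estimate, of the subgradient of \<open>R\<close> chosen by the proximal step, of the multiplier, of \<open>X\<close> and of
  \<open>Xbar\<close> in step \<open>k + 1\<close>, and with \<open>\<lambda>'\<close> the preceding multiplier deviation, the Lyapunov function
  \<open>\<parallel>Xbar + \<alpha> D\<^sup>T \<Lambda> - (X\<^sup>* + \<alpha> D\<^sup>T \<Lambda>\<^sup>* )\<parallel>\<^sup>2 + \<alpha> \<parallel>\<Lambda> - \<Lambda>\<^sup>*\<parallel>\<^sup>2\<close> (multipliers are measured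
  in the norm weighted by \<open>J\<close>) changes in step \<open>k + 1\<close> by exactly
  \<open>- \<alpha> \<parallel>\<lambda> - \<lambda>'\<parallel>\<^sup>2 - 2 \<alpha> \<langle>x, g\<rangle> - 2 \<alpha> \<langle>y, \<theta>\<rangle> + \<alpha>\<^sup>2 \<parallel>g\<parallel>\<^sup>2 - \<alpha>\<^sup>2 \<parallel>\<theta> + D\<^sup>T \<lambda>\<parallel>\<^sup>2\<close>.
  Unbiasedness and convexity bound the expectations of the two inner products below by the two
  Bregman divergences. Adding \<open>\<kappa> \<alpha>\<^sup>2 \<sigma>\<^sup>2\<close> to the Lyapunov function compensates the second moment of
  \<open>g\<close>, and the step size condition leaves a decrease of at least \<open>\<alpha>\<close> times the divergences.
  Telescoping and Jensen's inequality finish the argument. Square integrability of the iterates,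
  needed to take expectations, is propagated along the way.\<close>

section \<open>Gradients and extended-valued convex functions\<close>

lemma gradient_eqI:
  assumes "GDERIV h x :> v"
  shows "gradient h x = v"
  unfolding gradient_def
proof (rule the_equality)
  show "GDERIV h x :> v" by (rule assms)
next
  fix w assume "GDERIV h x :> w"
  then have "(\<lambda>u. u \<bullet> w) = (\<lambda>u. u \<bullet> v)"
    using assms has_derivative_unique unfolding gderiv_def by blast
  then show "w = v"
    by (metis vector_eq_ldot)
qed

text \<open>Convexity controls difference quotients along a segment, that is for \<open>t\<close> in
  (0,1), so the one-sided limit is the form needed.\<close>

lemma GDERIV_directional:
  fixes h :: "'a::real_inner \<Rightarrow> real"
  assumes "GDERIV h x :> v"
  shows "((\<lambda>t. (h (x + t *\<^sub>R u) - h x) / t) \<longlongrightarrow> v \<bullet> u) (at_right 0)"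
proof -
  have d: "(h has_derivative (\<lambda>w. w \<bullet> v)) (at (x + 0 *\<^sub>R u))"
    using assms unfolding gderiv_def by simp
  have "((\<lambda>t. x + t *\<^sub>R u) has_derivative (\<lambda>t. t *\<^sub>R u)) (at 0)"
    by (auto intro!: derivative_eq_intros)
  from has_derivative_compose[OF this d]
  have "((\<lambda>t. h (x + t *\<^sub>R u)) has_real_derivative (v \<bullet> u)) (at 0)"
    by (simp add: has_field_derivative_def inner_commute mult.commute[of _ "u \<bullet> v"])
  then have "((\<lambda>t. (h (x + t *\<^sub>R u) - h x) / t) \<longlongrightarrow> v \<bullet> u) (at 0)"
    by (simp add: has_field_derivative_iff)
  then show ?thesis
    by (rule filterlim_mono[OF _ order_refl at_le]) simp
qed

lemma at_right_segment_bound: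
  fixes q :: "real \<Rightarrow> real"
  assumes "(q \<longlongrightarrow> l) (at_right 0)" and "\<And>t. 0 < t \<Longrightarrow> t < 1 \<Longrightarrow> q t \<le> c"
  shows "l \<le> c"
proof (rule tendsto_upperbound[OF assms(1)])
  show "\<forall>\<^sub>F t in at_right 0. q t \<le> c"
    using assms(2) unfolding eventually_at_right_field by (auto intro!: exI[of _ "1::real"])
qed simp

text \<open>By convexity the difference quotient from \<open>x\<close> towards \<open>y\<close>
  never exceeds \<open>F y - F x\<close>; its limit for \<open>t\<close> tending to 0 inherits the
  bound.\<close>

lemma convex_gradient_ineq:
  fixes F :: "'a::real_inner \<Rightarrow> real"
  assumes cvx: "convex_on UNIV F" and D: "GDERIV F x :> v"
  shows "F x + v \<bullet> (y - x) \<le> F y"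
proof -
  have "v \<bullet> (y - x) \<le> F y - F x"
  proof (rule at_right_segment_bound[OF GDERIV_directional[OF D]])
    fix t :: real assume t: "0 < t" "t < 1"
    have "F (x + t *\<^sub>R (y - x)) \<le> (1 - t) * F x + t * F y"
      using convex_onD[OF cvx, of t x y] t by (simp add: algebra_simps)
    then have "F (x + t *\<^sub>R (y - x)) - F x \<le> (F y - F x) * t"
      by (simp add: algebra_simps)
    then show "(F (x + t *\<^sub>R (y - x)) - F x) / t \<le> F y - F x"
      using t by (simp add: divide_le_eq)
  qed
  then show ?thesis by simp
qed

section \<open>Convexity and measurability through epigraphs\<close>

lemma convex_epigraphD:
  assumes "convex (ereal_epigraph R)" "R x \<le> ereal a" "R y \<le> ereal c" "0 \<le> t" "t \<le> 1"
  shows "R ((1 - t) *\<^sub>R x + t *\<^sub>R y) \<le> ereal ((1 - t) * a + t * c)"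
proof -
  have "(x, a) \<in> ereal_epigraph R" "(y, c) \<in> ereal_epigraph R"
    using assms unfolding ereal_epigraph_def by auto
  then have "(1 - t) *\<^sub>R (x, a) + t *\<^sub>R (y, c) \<in> ereal_epigraph R"
    using assms convexD[OF assms(1), of "(x, a)" "(y, c)" "1 - t" t] by simp
  then show ?thesis
    unfolding ereal_epigraph_def by simp
qed

lemma convex_epigraph_sum:
  fixes R :: "'a::real_normed_vector \<Rightarrow> ereal"
  assumes "convex (ereal_epigraph R)" "finite I" "sum w I = 1"
    and "\<And>i. i \<in> I \<Longrightarrow> w i \<ge> 0" and "\<And>i. i \<in> I \<Longrightarrow> R (x i) \<le> ereal (a i)"
  shows "R (\<Sum>i\<in>I. w i *\<^sub>R x i) \<le> ereal (\<Sum>i\<in>I. w i * a i)"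
proof -
  have "(\<Sum>i\<in>I. w i *\<^sub>R (x i, a i)) \<in> ereal_epigraph R"
    using assms by (intro convex_sum) (auto simp: ereal_epigraph_def)
  then show ?thesis
    by (simp add: ereal_epigraph_def sum_prod case_prod_beta' fst_sum snd_sum)
qed

text \<open>Horizontal slices of a closed epigraph are closed, so \<open>R\<close> is lower
  semicontinuous.\<close>

lemma closed_epigraph_borel:
  fixes R :: "'a::euclidean_space \<Rightarrow> ereal"
  assumes "closed (ereal_epigraph R)"
  shows "R \<in> borel_measurable borel"
proof -
  have r: "closed {x. R x \<le> ereal c}" for c
  proof -
    have "closed ((\<lambda>x. (x, c)) -` ereal_epigraph R)"
      by (intro closed_vimage assms continuous_intros)
    then show ?thesis by (simp add: ereal_epigraph_def vimage_def)
  qed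
  have "R -` {..a} \<in> sets borel" for a
  proof (cases a)
    case (real c)
    then show ?thesis using r[of c] by (simp add: vimage_def borel_closed)
  next
    case PInf
    then have "R -` {..a} = UNIV" by auto
    then show ?thesis by simp
  next
    \<comment> \<open>This level is not a slice of the epigraph; it is the intersection of the
      levels \<open>- real n\<close>.\<close>
    case MInf
    have "R -` {..a} = (\<Inter>n::nat. {x. R x \<le> ereal (- real n)})"
    proof (intro equalityI subsetI)
      fix x assume x: "x \<in> (\<Inter>n::nat. {x. R x \<le> ereal (- real n)})"
      have "R x \<le> ereal c" for c
      proof -
        obtain n where "- c \<le> real n" using real_arch_simple by blast
        then have "ereal (- real n) \<le> ereal c" by simp
        moreover have "R x \<le> ereal (- real n)" using x by blast
        ultimately show ?thesis by (rule order_trans[rotated])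
      qed
      then show "x \<in> R -` {..a}" using ereal_bot MInf by simp
    qed (use MInf in auto)
    then show ?thesis using r by (simp add: borel_closed)
  qed
  then show ?thesis
    by (subst borel_measurable_iff_Iic_ereal) simp
qed

text \<open>Fermat's rule: on the way from \<open>x\<close> to \<open>y\<close>, \<open>R\<close>
  grows by at most \<open>t * (c - a)\<close>, so minimality lets \<open>\<phi>\<close> fall by at
  most that much; divide by \<open>t\<close> and let it tend to 0. It serves both the proximal step
  and the saddle point.\<close>

lemma minimizer_subgradient:
  fixes \<phi> :: "'a::real_inner \<Rightarrow> real"
  assumes cvx: "convex (ereal_epigraph R)" and nminf: "\<And>y. R y \<noteq> -\<infinity>" and a: "R x = ereal a"
    and D: "GDERIV \<phi> x :> v"
    and min: "\<And>y. ereal (\<phi> x) + R x \<le> ereal (\<phi> y) + R y"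
  shows "R x + ereal (- v \<bullet> (y - x)) \<le> R y"
proof (cases "R y")
  case (real c)
  have "a - c \<le> v \<bullet> (y - x)"
  proof -
    have "((\<lambda>t. - ((\<phi> (x + t *\<^sub>R (y - x)) - \<phi> x) / t)) \<longlongrightarrow> - (v \<bullet> (y - x))) (at_right 0)"
      by (intro tendsto_minus GDERIV_directional D)
    moreover have "- ((\<phi> (x + t *\<^sub>R (y - x)) - \<phi> x) / t) \<le> c - a" if t: "0 < t" "t < 1" for t
    proof -
      let ?z = "x + t *\<^sub>R (y - x)"
      have "R ((1 - t) *\<^sub>R x + t *\<^sub>R y) \<le> ereal ((1 - t) * a + t * c)"
        by (rule convex_epigraphD[OF cvx]) (use a real t in auto)
      also have "(1 - t) *\<^sub>R x + t *\<^sub>R y = ?z" by (simp add: algebra_simps)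
      finally have "ereal (\<phi> x) + R x \<le> ereal (\<phi> ?z) + ereal ((1 - t) * a + t * c)"
        using min[of ?z] add_left_mono order_trans by blast
      then have "- (\<phi> ?z - \<phi> x) \<le> (c - a) * t"
        using a by (simp add: algebra_simps)
      then have "- (\<phi> ?z - \<phi> x) / t \<le> c - a"
        using t by (subst pos_divide_le_eq) auto
      then show ?thesis by (simp only: minus_divide_left)
    qed
    ultimately have "- (v \<bullet> (y - x)) \<le> c - a" by (rule at_right_segment_bound)
    then show ?thesis by simp
  qed
  then show ?thesis using a real by simp
next
  case MInf then show ?thesis using nminf by blast
qed simp

section \<open>Proximal operators and quadratic minimization\<close>

text \<open>\<open>ARG_MIN\<close> is a Hilbert choice and is known to be a minimizer once some
  minimizer \<open>x\<close> exists.\<close>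

lemma arg_min_le:
  fixes h :: "'a \<Rightarrow> 'b::linorder"
  assumes "\<And>y. h x \<le> h y"
  shows "h (ARG_MIN h z. True) \<le> h y"
proof -
  have "is_arg_min h (\<lambda>z. True) (ARG_MIN h z. True)"
    unfolding arg_min_def
    by (rule someI[of _ x]) (use assms in \<open>auto simp: is_arg_min_linorder\<close>)
  then show ?thesis by (simp add: is_arg_min_linorder)
qed

text \<open>The affine minorant with slope \<open>\<theta>\<close> makes the proximal objective coercive.\<close>

lemma prox_objective_attains_min:
  fixes R :: "'a::euclidean_space \<Rightarrow> ereal"
  assumes pos: "\<alpha> > 0" and cl: "closed (ereal_epigraph R)" and a: "R x0 = ereal a"
    and minor: "\<And>y. R x0 + ereal (\<theta> \<bullet> (y - x0)) \<le> R y"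
  obtains V where "\<And>W. R V + ereal (1 / (2 * \<alpha>) * (norm (V - Z))\<^sup>2)
      \<le> R W + ereal (1 / (2 * \<alpha>) * (norm (W - Z))\<^sup>2)"
proof -
  define q where "q V = 1 / (2 * \<alpha>) * (norm (V - Z))\<^sup>2" for V
  define h where "h p = snd p + q (fst p)" for p :: "'a \<times> real"
  have h_cont: "continuous_on S h" for S
    unfolding h_def q_def by (intro continuous_intros)
  \<comment> \<open>Minimizing the continuous \<open>h\<close> over this part of the closed epigraph
    replaces minimizing the extended-valued objective; the cut at the value of
    \<open>(x0, a)\<close> makes the set compact.\<close>
  define S where "S = ereal_epigraph R \<inter> {p. h p \<le> a + q x0}"
  have "closed S"
    unfolding S_def by (intro closed_Int cl closed_Collect_le h_cont continuous_intros)
  \<comment> \<open>Completing the square: the minorant and the cut at \<open>x0\<close> confine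
    \<open>V\<close> to the ball around \<open>Z - \<alpha> *\<^sub>R \<theta>\<close> with squared
    radius \<open>C\<close>.\<close>
  define C where "C = (norm (x0 - Z + \<alpha> *\<^sub>R \<theta>))\<^sup>2"
  define \<rho> where "\<rho> = sqrt C"
  have bound: "V \<in> cball (Z - \<alpha> *\<^sub>R \<theta>) \<rho> \<and> a + \<theta> \<bullet> (V - x0) \<le> t \<and> t \<le> a + q x0"
    if "(V, t) \<in> S" for V t
  proof -
    have "R V \<le> ereal t" and le: "t + q V \<le> a + q x0"
      using that unfolding S_def ereal_epigraph_def h_def by auto
    then have tl: "a + \<theta> \<bullet> (V - x0) \<le> t"
      using order_trans[OF minor] a by fastforce
    have "q V \<ge> 0" using pos by (simp add: q_def)
    have "\<theta> \<bullet> (V - x0) + q V \<le> q x0" using tl le by simp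
    then have "2 * \<alpha> * (\<theta> \<bullet> (V - x0)) + 2 * \<alpha> * q V \<le> 2 * \<alpha> * q x0"
      using pos by (metis distrib_left mult_le_cancel_left_pos zero_less_mult_iff zero_less_numeral)
    then have "2 * \<alpha> * (\<theta> \<bullet> (V - x0)) + (norm (V - Z))\<^sup>2 \<le> (norm (x0 - Z))\<^sup>2"
      using pos by (simp add: q_def)
    then have "(norm (V - Z + \<alpha> *\<^sub>R \<theta>))\<^sup>2 \<le> C"
      unfolding C_def power2_norm_eq_inner
      by (simp add: algebra_simps inner_add_left inner_add_right inner_diff_left inner_diff_right inner_commute)
    then have "norm (V - Z + \<alpha> *\<^sub>R \<theta>) \<le> \<rho>"
      unfolding \<rho>_def by (rule real_le_rsqrt)
    then have "V \<in> cball (Z - \<alpha> *\<^sub>R \<theta>) \<rho>"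
      by (simp add: dist_norm norm_minus_commute algebra_simps)
    then show ?thesis using tl le \<open>q V \<ge> 0\<close> by simp
  qed
  \<comment> \<open>The ball bounds \<open>V\<close>; over this ball the affine minorant bounds
    \<open>t\<close> from below by Cauchy-Schwarz.\<close>
  have "bounded S"
  proof (rule bounded_subset)
    let ?c = "Z - \<alpha> *\<^sub>R \<theta>"
    let ?l = "a - norm \<theta> * (\<rho> + norm (?c - x0))"
    show "bounded (cball ?c \<rho> \<times> {?l..a + q x0})"
      by (intro bounded_Times bounded_cball bounded_closed_interval)
    show "S \<subseteq> cball ?c \<rho> \<times> {?l..a + q x0}"
    proof clarify
      fix V t assume Vt: "(V, t) \<in> S"
      have "norm (V - x0) \<le> norm (V - ?c) + norm (?c - x0)"
        by (metis diff_add_cancel add_diff_eq norm_triangle_ineq)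
      also have "norm (V - ?c) \<le> \<rho>"
        using bound[OF Vt] by (simp add: dist_norm norm_minus_commute)
      finally have "norm \<theta> * norm (V - x0) \<le> norm \<theta> * (\<rho> + norm (?c - x0))"
        by (intro mult_left_mono) auto
      moreover have "\<bar>\<theta> \<bullet> (V - x0)\<bar> \<le> norm \<theta> * norm (V - x0)"
        by (rule Cauchy_Schwarz_ineq2)
      ultimately show "V \<in> cball ?c \<rho> \<and> t \<in> {?l..a + q x0}"
        using bound[OF Vt] by auto
    qed
  qed
  with \<open>closed S\<close> have "compact S" by (simp add: compact_eq_bounded_closed)
  moreover have in_S: "(x0, a) \<in> S"
    using a unfolding S_def ereal_epigraph_def h_def by simp
  ultimately obtain p where p: "p \<in> S" "\<And>p'. p' \<in> S \<Longrightarrow> h p \<le> h p'"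
    using continuous_attains_inf[OF _ _ h_cont, of S] by blast
  obtain V t where Vt: "p = (V, t)" by (cases p)
  have RV: "R V \<le> ereal t" using p(1) Vt unfolding S_def ereal_epigraph_def by simp
  have "R V + ereal (q V) \<le> R W + ereal (q W)" for W
  proof (cases "R W")
    case (real c)
    have "R V + ereal (q V) \<le> ereal t + ereal (q V)"
      by (rule add_right_mono[OF RV])
    also have "\<dots> = ereal (h p)" by (simp add: h_def Vt)
    \<comment> \<open>Points of the epigraph outside \<open>S\<close> lie above the value at
      \<open>(x0, a)\<close>, which the minimum over \<open>S\<close> does not exceed.\<close>
    also have "h p \<le> c + q W"
    proof (cases "(W, c) \<in> S")
      case True
      then show ?thesis using p(2) by (fastforce simp: h_def)
    next
      case False
      then have "a + q x0 < c + q W"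
        using real unfolding S_def ereal_epigraph_def h_def by auto
      moreover have "h p \<le> h (x0, a)" by (rule p(2)[OF in_S])
      ultimately show ?thesis by (simp add: h_def)
    qed
    finally show ?thesis using real by simp
  next
    case MInf
    then show ?thesis using minor[of W] a by simp
  qed simp
  then show ?thesis
    by (intro that) (simp add: q_def)
qed

text \<open>First-order optimality: the gradient of the quadratic at the proximal point is the
  negative of the claimed subgradient. The minorant ensures that the point exists, and the finite
  value at \<open>x0\<close> makes \<open>R\<close> finite there.\<close>

lemma prox_subgradient:
  fixes R :: "'a::euclidean_space \<Rightarrow> ereal"
  assumes pos: "\<alpha> > 0" and R: "proper_closed_convex R" and a: "R x0 = ereal a"
    and minor: "\<And>y. R x0 + ereal (\<theta> \<bullet> (y - x0)) \<le> R y"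
  shows "\<bar>R (prox \<alpha> R Z)\<bar> \<noteq> \<infinity>"
    and "R (prox \<alpha> R Z) + ereal ((1 / \<alpha>) *\<^sub>R (Z - prox \<alpha> R Z) \<bullet> (y - prox \<alpha> R Z)) \<le> R y"
proof -
  let ?P = "prox \<alpha> R Z"
  define q where "q V = 1 / (2 * \<alpha>) * (norm (V - Z))\<^sup>2" for V
  have cl: "closed (ereal_epigraph R)" and cvx: "convex (ereal_epigraph R)"
    and nminf: "\<And>y. R y \<noteq> -\<infinity>"
    using R unfolding proper_closed_convex_def by auto
  obtain V where "\<And>W. R V + ereal (q V) \<le> R W + ereal (q W)"
    using prox_objective_attains_min[OF pos cl a minor] unfolding q_def by metis
  then have min: "R ?P + ereal (q ?P) \<le> R W + ereal (q W)" for W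
    using arg_min_le[of "\<lambda>V. R V + ereal (q V)" V W] unfolding prox_def q_def by blast
  then have "R ?P + ereal (q ?P) \<le> ereal (a + q x0)"
    using a by (metis plus_ereal.simps(1))
  then show fin: "\<bar>R ?P\<bar> \<noteq> \<infinity>"
    using nminf[of ?P] by (cases "R ?P") auto
  then obtain c where c: "R ?P = ereal c" by auto
  have q_inner: "q = (\<lambda>V. 1 / (2 * \<alpha>) * ((V - Z) \<bullet> (V - Z)))"
    unfolding q_def by (simp add: power2_norm_eq_inner)
  have D: "GDERIV q ?P :> (1 / \<alpha>) *\<^sub>R (?P - Z)"
    unfolding gderiv_def q_inner
    using pos by (auto intro!: derivative_eq_intros simp: inner_commute)
  have "R ?P + ereal (- ((1 / \<alpha>) *\<^sub>R (?P - Z)) \<bullet> (y - ?P)) \<le> R y"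
    by (rule minimizer_subgradient[OF cvx nminf c D]) (use min in \<open>simp add: add.commute\<close>)
  then show "R ?P + ereal ((1 / \<alpha>) *\<^sub>R (Z - ?P) \<bullet> (y - ?P)) \<le> R y"
    by (simp add: minus_diff_eq[symmetric, of Z] del: minus_diff_eq)
qed

lemma subgradient_monotone:
  fixes R :: "'a::real_inner \<Rightarrow> ereal"
  assumes "\<bar>R x\<bar> \<noteq> \<infinity>" "\<bar>R y\<bar> \<noteq> \<infinity>"
    and "R x + ereal (u \<bullet> (y - x)) \<le> R y" and "R y + ereal (v \<bullet> (x - y)) \<le> R x"
  shows "0 \<le> (u - v) \<bullet> (x - y)"
proof -
  obtain p q where "R x = ereal p" "R y = ereal q" using assms(1,2) by auto
  then show ?thesis
    using assms(3,4) by (simp add: inner_diff_left inner_diff_right)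
qed

text \<open>Monotonicity of the subgradients gives firm nonexpansiveness, and Cauchy-Schwarz removes
  one factor. The Lipschitz bound later yields measurability and second moments of
  \<open>Xbar\<close>.\<close>

lemma prox_nonexpansive:
  fixes R :: "'a::euclidean_space \<Rightarrow> ereal"
  assumes pos: "\<alpha> > 0" and R: "proper_closed_convex R" and a: "R x0 = ereal a"
    and minor: "\<And>y. R x0 + ereal (\<theta> \<bullet> (y - x0)) \<le> R y"
  shows "1-lipschitz_on UNIV (prox \<alpha> R)"
proof (rule lipschitz_onI)
  fix Z W
  let ?P = "prox \<alpha> R Z" and ?S = "prox \<alpha> R W"
  note ps = prox_subgradient[OF pos R a minor]
  have "0 \<le> ((1 / \<alpha>) *\<^sub>R (Z - ?P) - (1 / \<alpha>) *\<^sub>R (W - ?S)) \<bullet> (?P - ?S)"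
    by (rule subgradient_monotone[where R = R]) (rule ps)+
  also have "\<dots> = (1 / \<alpha>) * (((Z - ?P) - (W - ?S)) \<bullet> (?P - ?S))"
    by (simp add: inner_diff_left algebra_simps)
  finally have "0 \<le> ((Z - ?P) - (W - ?S)) \<bullet> (?P - ?S)"
    using pos by (simp add: zero_le_divide_iff)
  then have "(norm (?P - ?S))\<^sup>2 \<le> (Z - W) \<bullet> (?P - ?S)"
    unfolding power2_norm_eq_inner by (simp add: inner_diff_left)
  also have "\<dots> \<le> norm (Z - W) * norm (?P - ?S)" by (rule norm_cauchy_schwarz)
  finally have "norm (?P - ?S) \<le> norm (Z - W)"
    by (cases "norm (?P - ?S) = 0") (auto simp: power2_eq_square)
  then show "dist ?P ?S \<le> 1 * dist Z W" by (simp add: dist_norm)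
qed simp

section \<open>Positive definite operators and the explicit dual step\<close>

lemma pos_def_bij:
  fixes Q :: "'b::euclidean_space \<Rightarrow> 'b"
  assumes "pos_def Q"
  shows "bij Q"
proof -
  have lin: "linear Q" using assms unfolding pos_def_def self_adjoint_def by auto
  have "inj Q"
    unfolding linear_injective_0[OF lin]
    using assms unfolding pos_def_def by (metis inner_zero_right less_irrefl)
  then show ?thesis
    using linear_injective_imp_surjective[OF lin] by (simp add: bij_def)
qed

lemma weighted_norm_sq_diff:
  assumes "self_adjoint Q"
  shows "weighted_norm_sq Q (x - y)
    = weighted_norm_sq Q x - 2 * (x \<bullet> Q y) + weighted_norm_sq Q y"
proof -
  have lin: "linear Q" and sa: "Q u \<bullet> v = u \<bullet> Q v" for u v
    using assms unfolding self_adjoint_def by auto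
  show ?thesis
    unfolding weighted_norm_sq_def
    using sa[of y x] by (simp add: linear_diff[OF lin] inner_diff_left inner_diff_right inner_commute)
qed

text \<open>Completing the square shows that the minimizer is unique, which determines the value of
  \<open>ARG_MIN\<close> and makes the dual step an explicit affine map.\<close>

lemma arg_min_quadratic:
  fixes Q :: "'b::euclidean_space \<Rightarrow> 'b"
  assumes pd: "pos_def Q"
  shows "(ARG_MIN (\<lambda>\<Theta>. 1 / 2 * weighted_norm_sq Q (\<Theta> - \<Lambda>) + \<Theta> \<bullet> c) \<Theta>. True)
    = \<Lambda> - inv Q c" (is "?M = ?T")
proof -
  have sa: "self_adjoint Q" and pos: "x \<noteq> 0 \<Longrightarrow> weighted_norm_sq Q x > 0" for x
    using pd unfolding pos_def_def weighted_norm_sq_def by auto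
  have Qi: "Q (inv Q c) = c"
    using pos_def_bij[OF pd] by (simp add: bij_is_surj surj_f_inv_f)
  let ?h = "\<lambda>\<Theta>. 1 / 2 * weighted_norm_sq Q (\<Theta> - \<Lambda>) + \<Theta> \<bullet> c"
  have split: "?h \<Theta> = ?h ?T + 1 / 2 * weighted_norm_sq Q (\<Theta> - ?T)" for \<Theta>
  proof -
    have "weighted_norm_sq Q (\<Theta> - \<Lambda> - (- inv Q c))
      = weighted_norm_sq Q (\<Theta> - \<Lambda>) - 2 * ((\<Theta> - \<Lambda>) \<bullet> Q (- inv Q c)) + weighted_norm_sq Q (- inv Q c)"
      by (rule weighted_norm_sq_diff[OF sa])
    moreover have "Q (- inv Q c) = - c"
      using sa Qi linear_neg unfolding self_adjoint_def by metis
    moreover have "\<Theta> - \<Lambda> - (- inv Q c) = \<Theta> - ?T" by simp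
    ultimately show ?thesis
      by (simp add: inner_diff_left weighted_norm_sq_def algebra_simps inner_add_left)
  qed
  have nonneg: "weighted_norm_sq Q x \<ge> 0" for x
    using pos[of x] by (cases "x = 0") (auto simp: weighted_norm_sq_def)
  have "?h ?T \<le> ?h \<Theta>" for \<Theta>
    unfolding split[of \<Theta>] using nonneg by simp
  then have "?h ?M \<le> ?h ?T" by (rule arg_min_le)
  then have "weighted_norm_sq Q (?M - ?T) \<le> 0"
    unfolding split[of ?M] by simp
  then have "?M - ?T = 0" using pos[of "?M - ?T"] by fastforce
  then show ?thesis by simp
qed

section \<open>The Lyapunov inequality along a single run\<close>

text \<open>The lifted structure is abstracted to a linear operator between Euclidean spaces.
  \<open>J_pd\<close> spells out the operator that gets the name \<open>J\<close> inside the
  locale.\<close>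

locale primal_dual =
  fixes F :: "'a::euclidean_space \<Rightarrow> real" and R :: "'a \<Rightarrow> ereal"
    and A :: "'a \<Rightarrow> 'b::euclidean_space" and b :: 'b and Q :: "'b \<Rightarrow> 'b"
    and L \<alpha> :: real and Xs :: 'a and \<Lambda>s :: 'b
  assumes F_convex: "convex_on UNIV F"
    and F_gderiv: "GDERIV F x :> gradient F x"
    and F_smooth: "L-lipschitz_on UNIV (gradient F)"
    and R_pcc: "proper_closed_convex R"
    and A_linear: "linear A"
    and Q_sa: "self_adjoint Q"
    and \<alpha>_pos: "\<alpha> > 0"
    and J_pd: "pos_def (\<lambda>v. Q v - \<alpha> *\<^sub>R A (adjoint A v))"
    and saddle: "(Xs, \<Lambda>s) \<in> saddle_points (lagrangian F R A b)"
begin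

abbreviation "At \<equiv> adjoint A"

definition "J v = Q v - \<alpha> *\<^sub>R A (At v)"

definition "\<theta>s = - gradient F Xs - At \<Lambda>s"

text \<open>\<open>real_of_ereal\<close> maps infinite values to 0, so \<open>DR\<close> represents
  the divergence where \<open>R\<close> is finite, as it is at proximal points and their
  averages.\<close>

definition "DR X = real_of_ereal (bregman_sub R \<theta>s X Xs)"

lemma At_linear: "linear At"
  by (rule adjoint_linear[OF A_linear])

lemma At_inner: "x \<bullet> At y = A x \<bullet> y"
  by (rule adjoint_works[OF A_linear])

lemma R_not_MInf: "R y \<noteq> -\<infinity>"
  using R_pcc unfolding proper_closed_convex_def by blast

lemma R_convex: "convex (ereal_epigraph R)"
  using R_pcc unfolding proper_closed_convex_def by blast

lemma J_pos_def: "pos_def J"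
  using J_pd unfolding J_def[abs_def] .

text \<open>\<open>Q\<close> is \<open>J\<close> plus a positive semidefinite operator. Definiteness
  of \<open>Q\<close> makes the dual step well posed.\<close>

lemma Q_pos_def: "pos_def Q"
  unfolding pos_def_def
proof (intro conjI Q_sa allI impI)
  fix v :: 'b assume "v \<noteq> 0"
  then have "0 < v \<bullet> J v" using J_pos_def unfolding pos_def_def by blast
  also have "v \<bullet> J v = v \<bullet> Q v - \<alpha> * (norm (At v))\<^sup>2"
    using At_inner[of "At v" v]
    by (simp add: J_def inner_diff_right power2_norm_eq_inner inner_commute)
  also have "\<dots> \<le> v \<bullet> Q v" using \<alpha>_pos by simp
  finally show "0 < v \<bullet> Q v" .
qed

lemma J_norm_nonneg: "weighted_norm_sq J v \<ge> 0"
  using J_pos_def unfolding pos_def_def weighted_norm_sq_def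
  by (cases "v = 0") (auto simp: less_imp_le)

section \<open>Consequences of the saddle-point property\<close>

lemma saddle_primal: "lagrangian F R A b Xs \<Lambda>s \<le> lagrangian F R A b X \<Lambda>s"
  and saddle_dual: "lagrangian F R A b Xs \<Lambda> \<le> lagrangian F R A b Xs \<Lambda>s"
  using saddle unfolding saddle_points_def by auto

lemma R_Xs_finite: "\<bar>R Xs\<bar> \<noteq> \<infinity>"
proof -
  obtain y where "R y \<noteq> \<infinity>" using R_pcc unfolding proper_closed_convex_def by blast
  then have "\<bar>R y\<bar> \<noteq> \<infinity>" using R_not_MInf[of y] by auto
  moreover have "lagrangian F R A b Xs \<Lambda>s \<le> lagrangian F R A b y \<Lambda>s" by (rule saddle_primal)
  ultimately show ?thesis
    using R_not_MInf[of Xs] unfolding lagrangian_def by (cases "R Xs"; cases "R y") auto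
qed

text \<open>The Lagrangian is affine in the multiplier and maximal at \<open>\<Lambda>s\<close>, so
  its slope, the residual, vanishes; moving \<open>\<Lambda>s\<close> along the residual shows
  this.\<close>

lemma Xs_feasible: "A Xs = b"
proof -
  let ?v = "A Xs - b"
  have "(\<Lambda>s + ?v) \<bullet> ?v \<le> \<Lambda>s \<bullet> ?v"
    using saddle_dual[of "\<Lambda>s + ?v"] R_Xs_finite unfolding lagrangian_def by (cases "R Xs") auto
  then have "?v \<bullet> ?v \<le> 0" by (simp add: inner_add_left)
  then show ?thesis by (metis inner_gt_zero_iff linorder_not_less right_minus_eq)
qed

text \<open>\<open>Xs\<close> minimizes the Lagrangian with multiplier \<open>\<Lambda>s\<close>;
  Fermat's rule applies to its smooth part \<open>\<phi>\<close>, whose gradient at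
  \<open>Xs\<close> is the negative of \<open>\<theta>s\<close>.\<close>

lemma \<theta>s_subgradient: "R Xs + ereal (\<theta>s \<bullet> (y - Xs)) \<le> R y"
proof -
  define \<phi> where "\<phi> X = F X + \<Lambda>s \<bullet> (A X - b)" for X
  obtain a where a: "R Xs = ereal a" using R_Xs_finite by auto
  have "(A has_derivative A) (at Xs)"
    using A_linear by (simp add: linear_conv_bounded_linear bounded_linear_imp_has_derivative)
  then have "(\<phi> has_derivative (\<lambda>h. h \<bullet> gradient F Xs + \<Lambda>s \<bullet> A h)) (at Xs)"
    unfolding \<phi>_def using F_gderiv[of Xs] unfolding gderiv_def
    by (auto intro!: derivative_eq_intros)
  then have D: "GDERIV \<phi> Xs :> gradient F Xs + At \<Lambda>s"
    unfolding gderiv_def by (simp add: inner_add_right At_inner inner_commute)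
  have "R Xs + ereal (- (gradient F Xs + At \<Lambda>s) \<bullet> (y - Xs)) \<le> R y"
  proof (rule minimizer_subgradient[OF R_convex R_not_MInf a D])
    fix y show "ereal (\<phi> Xs) + R Xs \<le> ereal (\<phi> y) + R y"
      using saddle_primal[of y] a unfolding lagrangian_def \<phi>_def by (cases "R y") auto
  qed
  then show ?thesis by (simp add: \<theta>s_def)
qed

text \<open>The subgradient \<open>\<theta>s\<close> at \<open>Xs\<close> provides the affine
  minorant on which the existence of proximal points rests.\<close>

lemma
  shows R_prox_finite: "\<bar>R (prox \<alpha> R Z)\<bar> \<noteq> \<infinity>"
    and R_prox_subgradient:
      "R (prox \<alpha> R Z) + ereal ((1 / \<alpha>) *\<^sub>R (Z - prox \<alpha> R Z) \<bullet> (y - prox \<alpha> R Z)) \<le> R y"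
    and prox_lipschitz: "1-lipschitz_on UNIV (prox \<alpha> R)"
proof -
  obtain a where "R Xs = ereal a" using R_Xs_finite by auto
  note * = \<alpha>_pos R_pcc this \<theta>s_subgradient
  show "\<bar>R (prox \<alpha> R Z)\<bar> \<noteq> \<infinity>"
    "R (prox \<alpha> R Z) + ereal ((1 / \<alpha>) *\<^sub>R (Z - prox \<alpha> R Z) \<bullet> (y - prox \<alpha> R Z)) \<le> R y"
    "1-lipschitz_on UNIV (prox \<alpha> R)"
    by (rule prox_subgradient[OF *] prox_nonexpansive[OF *])+
qed

section \<open>Bregman divergences relative to the saddle point\<close>

lemma bregman_sub_finite:
  "\<bar>R X\<bar> \<noteq> \<infinity> \<Longrightarrow> bregman_sub R \<theta>s X Xs = ereal (DR X)"
  using R_Xs_finite unfolding DR_def bregman_sub_def by (cases "R X"; cases "R Xs") auto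

lemma R_eq_DR:
  "\<bar>R X\<bar> \<noteq> \<infinity> \<Longrightarrow> R X = ereal (DR X + real_of_ereal (R Xs) + \<theta>s \<bullet> (X - Xs))"
  using R_Xs_finite unfolding DR_def bregman_sub_def by (cases "R X"; cases "R Xs") auto

lemma DR_nonneg: "\<bar>R X\<bar> \<noteq> \<infinity> \<Longrightarrow> DR X \<ge> 0"
  using R_Xs_finite \<theta>s_subgradient[of X] unfolding DR_def bregman_sub_def
  by (cases "R X"; cases "R Xs") auto

lemma DR_le:
  assumes "\<bar>R X\<bar> \<noteq> \<infinity>" "R X + ereal (v \<bullet> (Xs - X)) \<le> R Xs"
  shows "DR X \<le> (v - \<theta>s) \<bullet> (X - Xs)"
  using R_Xs_finite assms unfolding DR_def bregman_sub_def
  by (cases "R X"; cases "R Xs") (auto simp: inner_diff_left inner_diff_right)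

lemma bregman_nonneg: "bregman F X Xs \<ge> 0"
  using convex_gradient_ineq[OF F_convex F_gderiv, of Xs X] unfolding bregman_def by simp

text \<open>The inner product is the sum of the divergences in both orders of the arguments, and the
  reversed one is nonnegative by convexity.\<close>

lemma bregman_le: "bregman F X Xs \<le> (X - Xs) \<bullet> (gradient F X - gradient F Xs)"
  using convex_gradient_ineq[OF F_convex F_gderiv, of X Xs] unfolding bregman_def
  by (simp add: inner_diff_left inner_diff_right inner_commute)

text \<open>In its first argument the divergence is convex plus affine, and the affine part commutes
  with averages because the weights sum to 1.\<close>

lemma bregman_convex_sum:
  assumes "finite I" "sum w I = 1" "\<And>i. i \<in> I \<Longrightarrow> w i \<ge> 0"
  shows "bregman F (\<Sum>i\<in>I. w i *\<^sub>R x i) Xs \<le> (\<Sum>i\<in>I. w i * bregman F (x i) Xs)"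
proof -
  have I: "I \<noteq> {}" using assms by auto
  have "F (\<Sum>i\<in>I. w i *\<^sub>R x i) \<le> (\<Sum>i\<in>I. w i * F (x i))"
    using convex_on_sum[OF assms(1) I F_convex assms(2)] assms(3) by auto
  moreover have "(\<Sum>i\<in>I. w i * bregman F (x i) Xs)
      = (\<Sum>i\<in>I. w i * F (x i)) - (\<Sum>i\<in>I. w i) * F Xs
        - gradient F Xs \<bullet> ((\<Sum>i\<in>I. w i *\<^sub>R x i) - (\<Sum>i\<in>I. w i) *\<^sub>R Xs)"
    unfolding bregman_def
    by (simp add: algebra_simps sum.distrib sum_subtractf inner_sum_right sum_distrib_left
        inner_diff_right inner_add_right scaleR_left.sum)
  ultimately show ?thesis
    using assms(2) by (simp add: bregman_def)
qed

lemma DR_convex_sum: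
  assumes "finite I" "sum w I = 1" "\<And>i. i \<in> I \<Longrightarrow> w i \<ge> 0" "\<And>i. i \<in> I \<Longrightarrow> \<bar>R (x i)\<bar> \<noteq> \<infinity>"
  shows "\<bar>R (\<Sum>i\<in>I. w i *\<^sub>R x i)\<bar> \<noteq> \<infinity>"
    and "DR (\<Sum>i\<in>I. w i *\<^sub>R x i) \<le> (\<Sum>i\<in>I. w i * DR (x i))"
proof -
  let ?x = "\<Sum>i\<in>I. w i *\<^sub>R x i"
  let ?a = "\<lambda>i. DR (x i) + real_of_ereal (R Xs) + \<theta>s \<bullet> (x i - Xs)"
  have le: "R ?x \<le> ereal (\<Sum>i\<in>I. w i * ?a i)"
  proof (rule convex_epigraph_sum[OF R_convex assms(1,2,3)])
    fix i assume "i \<in> I"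
    then have "R (x i) = ereal (?a i)" by (intro R_eq_DR assms(4))
    then show "R (x i) \<le> ereal (?a i)" by simp
  qed
  then show fin: "\<bar>R ?x\<bar> \<noteq> \<infinity>" using R_not_MInf[of ?x] by (cases "R ?x") auto
  have "(\<Sum>i\<in>I. w i * ?a i) = (\<Sum>i\<in>I. w i * DR (x i)) + (\<Sum>i\<in>I. w i) * real_of_ereal (R Xs)
      + \<theta>s \<bullet> (?x - (\<Sum>i\<in>I. w i) *\<^sub>R Xs)"
    by (simp add: algebra_simps sum.distrib sum_subtractf inner_sum_right sum_distrib_left
        inner_diff_right inner_add_right scaleR_left.sum)
  with le show "DR ?x \<le> (\<Sum>i\<in>I. w i * DR (x i))"
    using assms(2) R_eq_DR[OF fin] by simp
qed

text \<open>By the correction step, \<open>Xbar k + \<alpha> *\<^sub>R At (\<Lambda> k)\<close>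
  equals \<open>X (Suc k) + \<alpha> *\<^sub>R At (\<Lambda> (Suc k))\<close>. The shifted point
  thus links the end of one step to the start of the next.\<close>

definition "lyapunov Y \<Lambda> = (norm (Y + \<alpha> *\<^sub>R At \<Lambda> - (\<alpha> *\<^sub>R At \<Lambda>s + Xs)))\<^sup>2
  + \<alpha> * weighted_norm_sq J (\<Lambda> - \<Lambda>s)"

lemma lyapunov_nonneg: "lyapunov Y \<Lambda> \<ge> 0"
  unfolding lyapunov_def using J_norm_nonneg \<alpha>_pos by simp

end

locale primal_dual_trajectory = primal_dual +
  fixes g X Xbar :: "nat \<Rightarrow> 'a" and \<Lambda> :: "nat \<Rightarrow> 'b"
  assumes run: "primal_dual_run \<alpha> R A b Q g X Xbar \<Lambda>"
begin

lemma \<Lambda>_0: "\<Lambda> 0 = 0"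
  and Xbar_eq: "Xbar k = prox \<alpha> R (X k - \<alpha> *\<^sub>R (At (\<Lambda> k) + g k))"
  and X_Suc: "X (Suc k) = Xbar k + \<alpha> *\<^sub>R At (\<Lambda> k - \<Lambda> (Suc k))"
  using run unfolding primal_dual_run_def by auto

lemma \<Lambda>_Suc: "\<Lambda> (Suc k) = \<Lambda> k - inv Q (b - A (Xbar k))"
  using run unfolding primal_dual_run_def arg_min_quadratic[OF Q_pos_def] by blast

lemma R_Xbar_finite: "\<bar>R (Xbar k)\<bar> \<noteq> \<infinity>"
  unfolding Xbar_eq by (rule R_prox_finite)

lemma lyapunov_0: "lyapunov (Xbar 0) (\<Lambda> 0)
    = (norm (Xbar 0 - (\<alpha> *\<^sub>R At \<Lambda>s + Xs)))\<^sup>2 + weighted_norm_sq (\<lambda>v. \<alpha> *\<^sub>R J v) \<Lambda>s"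
proof -
  have "linear J" using J_pos_def unfolding pos_def_def self_adjoint_def by blast
  then show ?thesis
    unfolding lyapunov_def weighted_norm_sq_def \<Lambda>_0
    by (simp add: linear_0[OF At_linear] linear_neg)
qed

text \<open>The dual update is linear in the primal residual also in the metric \<open>J\<close>, once the residual is
  taken at the corrected point \<open>X (Suc k)\<close> instead of \<open>Xbar k\<close>.\<close>

lemma J_dual_step: "J (\<Lambda> (Suc k) - \<Lambda> k) = A (X (Suc k) - Xs)"
proof -
  have Q_lin: "linear Q" using Q_sa unfolding self_adjoint_def by blast
  have "Q (inv Q (b - A (Xbar k))) = b - A (Xbar k)"
    using pos_def_bij[OF Q_pos_def] by (simp add: bij_is_surj surj_f_inv_f)
  then have "Q (\<Lambda> (Suc k) - \<Lambda> k) = A (Xbar k) - b"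
    unfolding \<Lambda>_Suc by (simp add: linear_neg[OF Q_lin])
  moreover have "At (\<Lambda> (Suc k) - \<Lambda> k) = - At (\<Lambda> k - \<Lambda> (Suc k))"
    by (simp add: linear_diff[OF At_linear])
  ultimately show ?thesis
    unfolding J_def X_Suc
    by (simp add: linear_diff[OF A_linear] linear_add[OF A_linear] linear_neg[OF A_linear]
        linear_scale[OF A_linear] Xs_feasible)
qed

text \<open>The exact change is weakened: two negative squares are dropped, and the inner product of
  \<open>xb\<close> and \<open>\<theta>\<close> is bounded below by \<open>DR\<close>.\<close>

lemma lyapunov_Suc:
  fixes k
  defines "x \<equiv> X (Suc k) - Xs" and "h \<equiv> g (Suc k) - gradient F Xs"
  shows "lyapunov (Xbar (Suc k)) (\<Lambda> (Suc k)) \<le> lyapunov (Xbar k) (\<Lambda> k)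
    - 2 * \<alpha> * (x \<bullet> h) - 2 * \<alpha> * DR (Xbar (Suc k)) + \<alpha>\<^sup>2 * (norm h)\<^sup>2"
proof -
  define l l' where "l = \<Lambda> k - \<Lambda>s" and "l' = \<Lambda> (Suc k) - \<Lambda>s"
  define p where "p = At l'"
  define Z where "Z = X (Suc k) - \<alpha> *\<^sub>R (At (\<Lambda> (Suc k)) + g (Suc k))"
  define \<theta> where "\<theta> = (1 / \<alpha>) *\<^sub>R (Z - Xbar (Suc k)) - \<theta>s"
  define xb where "xb = Xbar (Suc k) - Xs"
  have "\<alpha> *\<^sub>R (\<theta> + \<theta>s) = Z - Xbar (Suc k)" using \<alpha>_pos by (simp add: \<theta>_def)
  \<comment> \<open>The optimality condition of the proximal step minus the defining relation of
    \<open>\<theta>s\<close>: only deviations remain.\<close>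
  then have xb: "xb = x - \<alpha> *\<^sub>R (p + h + \<theta>)"
    unfolding xb_def x_def p_def l'_def h_def Z_def \<theta>s_def
    by (simp add: algebra_simps linear_diff[OF At_linear])
  have u: "Xbar k + \<alpha> *\<^sub>R At (\<Lambda> k) - (\<alpha> *\<^sub>R At \<Lambda>s + Xs) = x + \<alpha> *\<^sub>R p"
    unfolding x_def p_def l'_def X_Suc by (simp add: algebra_simps linear_diff[OF At_linear])
  have u': "Xbar (Suc k) + \<alpha> *\<^sub>R At (\<Lambda> (Suc k)) - (\<alpha> *\<^sub>R At \<Lambda>s + Xs) = xb + \<alpha> *\<^sub>R p"
    unfolding xb_def p_def l'_def by (simp add: algebra_simps linear_diff[OF At_linear])
  \<comment> \<open>The final term in \<open>x \<bullet> p\<close> cancels against the one in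
    \<open>dual\<close> after scaling by \<open>\<alpha>\<close>; this coupling is why the
    multipliers are measured by \<open>J\<close>.\<close>
  have primal: "(norm (xb + \<alpha> *\<^sub>R p))\<^sup>2 = (norm (x + \<alpha> *\<^sub>R p))\<^sup>2 - 2 * \<alpha> * (x \<bullet> h)
      - 2 * \<alpha> * (xb \<bullet> \<theta>) + \<alpha>\<^sup>2 * (norm h)\<^sup>2 - \<alpha>\<^sup>2 * (norm (\<theta> + p))\<^sup>2 - 2 * \<alpha> * (x \<bullet> p)"
    unfolding xb power2_norm_eq_inner
    by (simp add: inner_add_left inner_add_right inner_diff_left inner_diff_right
        inner_commute power2_eq_square algebra_simps)
  have J_sa: "self_adjoint J" using J_pos_def unfolding pos_def_def by blast
  have "l' - l = \<Lambda> (Suc k) - \<Lambda> k" by (simp add: l_def l'_def)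
  then have Jd: "J (l' - l) = A x" using J_dual_step by (simp add: x_def)
  have "weighted_norm_sq J l = weighted_norm_sq J (l' - (l' - l))" by simp
  also have "\<dots> = weighted_norm_sq J l' - 2 * (l' \<bullet> J (l' - l)) + weighted_norm_sq J (l' - l)"
    by (rule weighted_norm_sq_diff[OF J_sa])
  also have "l' \<bullet> J (l' - l) = x \<bullet> p"
    unfolding Jd p_def At_inner by (rule inner_commute)
  finally have dual: "weighted_norm_sq J l' \<le> weighted_norm_sq J l + 2 * (x \<bullet> p)"
    using J_norm_nonneg[of "l' - l"] by simp
  have "DR (Xbar (Suc k)) \<le> \<theta> \<bullet> xb"
    unfolding \<theta>_def xb_def
  proof (rule DR_le[OF R_Xbar_finite])
    show "R (Xbar (Suc k)) + ereal ((1 / \<alpha>) *\<^sub>R (Z - Xbar (Suc k)) \<bullet> (Xs - Xbar (Suc k))) \<le> R Xs"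
      using R_prox_subgradient[of Z Xs] unfolding Xbar_eq[of "Suc k"] Z_def .
  qed
  then have "2 * \<alpha> * DR (Xbar (Suc k)) \<le> 2 * \<alpha> * (xb \<bullet> \<theta>)"
    using \<alpha>_pos by (simp add: inner_commute)
  moreover have "\<alpha> * weighted_norm_sq J l' \<le> \<alpha> * weighted_norm_sq J l + 2 * \<alpha> * (x \<bullet> p)"
    using mult_left_mono[OF dual, of \<alpha>] \<alpha>_pos by (simp add: algebra_simps)
  moreover have "0 \<le> \<alpha>\<^sup>2 * (norm (\<theta> + p))\<^sup>2" by simp
  ultimately show ?thesis
    unfolding lyapunov_def u u' l_def[symmetric] l'_def[symmetric] using primal by linarith
qed

end

section \<open>Square-integrable random vectors and conditional expectations\<close>

text \<open>This is the class that the iteration propagates: on a finite measure Lipschitz maps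
  preserve it, and inner products of two members are integrable.\<close>

definition square_integrable :: "'w measure \<Rightarrow> ('w \<Rightarrow> 'a::euclidean_space) \<Rightarrow> bool" where
  "square_integrable M v \<longleftrightarrow> v \<in> borel_measurable M \<and> integrable M (\<lambda>\<omega>. (norm (v \<omega>))\<^sup>2)"

lemma power2_add_le: "(x + y)\<^sup>2 \<le> 2 * x\<^sup>2 + 2 * y\<^sup>2" for x y :: real
  using sum_squares_bound[of x y] by (simp add: power2_sum)

lemma square_integrable_cong:
  assumes "\<And>\<omega>. \<omega> \<in> space M \<Longrightarrow> v \<omega> = w \<omega>"
  shows "square_integrable M v \<longleftrightarrow> square_integrable M w"
proof -
  have "v \<in> borel_measurable M \<longleftrightarrow> w \<in> borel_measurable M"
    by (rule measurable_cong) (rule assms)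
  moreover have "integrable M (\<lambda>\<omega>. (norm (v \<omega>))\<^sup>2) \<longleftrightarrow> integrable M (\<lambda>\<omega>. (norm (w \<omega>))\<^sup>2)"
    by (rule Bochner_Integration.integrable_cong) (simp_all add: assms)
  ultimately show ?thesis unfolding square_integrable_def by simp
qed

lemma square_integrableD:
  assumes "square_integrable M v"
  shows "v \<in> borel_measurable M" and "integrable M (\<lambda>\<omega>. (norm (v \<omega>))\<^sup>2)"
  using assms unfolding square_integrable_def by auto

lemma square_integrable_add:
  assumes v: "square_integrable M v" and w: "square_integrable M w"
  shows "square_integrable M (\<lambda>\<omega>. v \<omega> + w \<omega>)"
  unfolding square_integrable_def
proof (intro conjI)
  note [measurable] = square_integrableD(1)[OF v] square_integrableD(1)[OF w]
  show "(\<lambda>\<omega>. v \<omega> + w \<omega>) \<in> borel_measurable M" by measurable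
  have bd: "(norm (v \<omega> + w \<omega>))\<^sup>2 \<le> 2 * (norm (v \<omega>))\<^sup>2 + 2 * (norm (w \<omega>))\<^sup>2" for \<omega>
    by (rule order_trans[OF power_mono[OF norm_triangle_ineq norm_ge_zero] power2_add_le])
  show "integrable M (\<lambda>\<omega>. (norm (v \<omega> + w \<omega>))\<^sup>2)"
    by (rule Bochner_Integration.integrable_bound
        [where f = "\<lambda>\<omega>. 2 * (norm (v \<omega>))\<^sup>2 + 2 * (norm (w \<omega>))\<^sup>2"])
      (use bd in \<open>auto simp: square_integrableD(2)[OF v] square_integrableD(2)[OF w]\<close>)
qed

lemma (in finite_measure) square_integrable_const: "square_integrable M (\<lambda>\<omega>. c)"
  unfolding square_integrable_def by simp

lemma (in finite_measure) square_integrable_lipschitz: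
  fixes h :: "'b::euclidean_space \<Rightarrow> 'c::euclidean_space"
  assumes h: "C-lipschitz_on UNIV h" and v: "square_integrable M v"
  shows "square_integrable M (\<lambda>\<omega>. h (v \<omega>))"
  unfolding square_integrable_def
proof (intro conjI)
  note [measurable] = square_integrableD(1)[OF v]
  have [measurable]: "h \<in> borel_measurable borel"
    by (rule borel_measurable_continuous_onI) (rule lipschitz_on_continuous_on[OF h])
  show "(\<lambda>\<omega>. h (v \<omega>)) \<in> borel_measurable M" by measurable
  have bd: "(norm (h (v \<omega>)))\<^sup>2 \<le> 2 * C\<^sup>2 * (norm (v \<omega>))\<^sup>2 + 2 * (norm (h 0))\<^sup>2" for \<omega>
  proof -
    have "norm (h (v \<omega>)) \<le> norm (h (v \<omega>) - h 0) + norm (h 0)" using norm_triangle_ineq[of "h (v \<omega>) - h 0" "h 0"] by simp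
    also have "norm (h (v \<omega>) - h 0) \<le> C * norm (v \<omega>)"
      using lipschitz_on_normD[OF h, of "v \<omega>" 0] by simp
    finally have "(norm (h (v \<omega>)))\<^sup>2 \<le> (C * norm (v \<omega>) + norm (h 0))\<^sup>2"
      by (intro power_mono) auto
    also have "\<dots> \<le> 2 * (C * norm (v \<omega>))\<^sup>2 + 2 * (norm (h 0))\<^sup>2" by (rule power2_add_le)
    finally show ?thesis by (simp add: power_mult_distrib)
  qed
  show "integrable M (\<lambda>\<omega>. (norm (h (v \<omega>)))\<^sup>2)"
    by (rule Bochner_Integration.integrable_bound
        [where f = "\<lambda>\<omega>. 2 * C\<^sup>2 * (norm (v \<omega>))\<^sup>2 + 2 * (norm (h 0))\<^sup>2"])
      (use bd in \<open>auto simp: square_integrableD(2)[OF v]\<close>)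
qed

lemma (in finite_measure) square_integrable_linear:
  fixes h :: "'b::euclidean_space \<Rightarrow> 'c::euclidean_space"
  assumes "linear h" and "square_integrable M v"
  shows "square_integrable M (\<lambda>\<omega>. h (v \<omega>))"
proof -
  have "bounded_linear h" using assms(1) linear_conv_bounded_linear by blast
  then obtain C where "C-lipschitz_on UNIV h" by (rule bounded_linear.lipschitz_boundE)
  then show ?thesis using assms(2) by (rule square_integrable_lipschitz)
qed

lemma (in finite_measure) square_integrable_scaleR:
  "square_integrable M v \<Longrightarrow> square_integrable M (\<lambda>\<omega>. c *\<^sub>R v \<omega>)"
  by (rule square_integrable_linear) (rule linear_scaleR)

lemma (in finite_measure) square_integrable_diff:
  assumes "square_integrable M v" and "square_integrable M w"
  shows "square_integrable M (\<lambda>\<omega>. v \<omega> - w \<omega>)"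
  using square_integrable_add[OF assms(1) square_integrable_scaleR[OF assms(2), of "-1"]] by simp

lemma square_integrable_inner:
  assumes v: "square_integrable M v" and w: "square_integrable M w"
  shows "integrable M (\<lambda>\<omega>. v \<omega> \<bullet> w \<omega>)"
proof (rule Bochner_Integration.integrable_bound
    [where f = "\<lambda>\<omega>. (norm (v \<omega>))\<^sup>2 + (norm (w \<omega>))\<^sup>2"])
  note [measurable] = square_integrableD(1)[OF v] square_integrableD(1)[OF w]
  show "(\<lambda>\<omega>. v \<omega> \<bullet> w \<omega>) \<in> borel_measurable M" by measurable
  have "\<bar>v \<omega> \<bullet> w \<omega>\<bar> \<le> (norm (v \<omega>))\<^sup>2 + (norm (w \<omega>))\<^sup>2" for \<omega>
  proof -
    have "\<bar>v \<omega> \<bullet> w \<omega>\<bar> \<le> norm (v \<omega>) * norm (w \<omega>)" by (rule Cauchy_Schwarz_ineq2)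
    also have "2 * (norm (v \<omega>) * norm (w \<omega>)) \<le> (norm (v \<omega>))\<^sup>2 + (norm (w \<omega>))\<^sup>2"
      using sum_squares_bound[of "norm (v \<omega>)" "norm (w \<omega>)"] by simp
    moreover have "0 \<le> norm (v \<omega>) * norm (w \<omega>)" by simp
    ultimately show ?thesis by linarith
  qed
  then show "AE \<omega> in M. norm (v \<omega> \<bullet> w \<omega>) \<le> norm ((norm (v \<omega>))\<^sup>2 + (norm (w \<omega>))\<^sup>2)"
    by simp
qed (simp add: square_integrableD(2)[OF v] square_integrableD(2)[OF w])

text \<open>Nonnegative conditional expectations can be integrated without knowing that
  \<open>h\<close> is integrable, so the conditional bound itself delivers integrability.\<close>

lemma (in sigma_finite_subalgebra) integral_le_of_nn_cond_exp_le:
  assumes [measurable]: "h \<in> borel_measurable M" and r: "integrable M r"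
    and h0: "\<And>\<omega>. \<omega> \<in> space M \<Longrightarrow> 0 \<le> h \<omega>" and r0: "\<And>\<omega>. \<omega> \<in> space M \<Longrightarrow> 0 \<le> r \<omega>"
    and le: "AE \<omega> in M. nn_cond_exp M F (\<lambda>\<omega>. ennreal (h \<omega>)) \<omega> \<le> ennreal (r \<omega>)"
  shows "integrable M h" and "(\<integral>\<omega>. h \<omega> \<partial>M) \<le> (\<integral>\<omega>. r \<omega> \<partial>M)"
proof -
  have "(\<integral>\<^sup>+\<omega>. ennreal (h \<omega>) \<partial>M) = (\<integral>\<^sup>+\<omega>. nn_cond_exp M F (\<lambda>\<omega>. ennreal (h \<omega>)) \<omega> \<partial>M)"
    using nn_cond_exp_intg[of "\<lambda>_. 1" "\<lambda>\<omega>. ennreal (h \<omega>)"] by simp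
  also have "\<dots> \<le> (\<integral>\<^sup>+\<omega>. ennreal (r \<omega>) \<partial>M)"
    by (rule nn_integral_mono_AE[OF le])
  also have "\<dots> = ennreal (\<integral>\<omega>. r \<omega> \<partial>M)"
    by (rule nn_integral_eq_integral[OF r]) (simp add: r0)
  finally have bound: "(\<integral>\<^sup>+\<omega>. ennreal (h \<omega>) \<partial>M) \<le> ennreal (\<integral>\<omega>. r \<omega> \<partial>M)" .
  then show h: "integrable M h"
    by (intro integrableI_nonneg) (auto simp: h0 intro: le_less_trans)
  have "(\<integral>\<^sup>+\<omega>. ennreal (h \<omega>) \<partial>M) = ennreal (\<integral>\<omega>. h \<omega> \<partial>M)"
    by (rule nn_integral_eq_integral[OF h]) (simp add: h0)
  moreover have "0 \<le> (\<integral>\<omega>. r \<omega> \<partial>M)" by (rule Bochner_Integration.integral_nonneg) (rule r0)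
  ultimately show "(\<integral>\<omega>. h \<omega> \<partial>M) \<le> (\<integral>\<omega>. r \<omega> \<partial>M)" using bound by simp
qed

text \<open>Each coordinate of \<open>w\<close> is measurable for the subalgebra and can be pulled
  out; square integrability makes the products integrable.\<close>

lemma (in sigma_finite_subalgebra) integral_inner_vec_cond_exp:
  fixes w Z :: "'a \<Rightarrow> 'c::euclidean_space"
  assumes fin: "finite_measure M" and w: "w \<in> borel_measurable F" "square_integrable M w"
    and Z: "square_integrable M Z"
  shows "(\<integral>\<omega>. w \<omega> \<bullet> vec_cond_exp M F Z \<omega> \<partial>M) = (\<integral>\<omega>. w \<omega> \<bullet> Z \<omega> \<partial>M)"
proof -
  interpret finite_measure M by (rule fin)
  note [measurable] = w(1) square_integrableD(1)[OF Z]
  have comp: "square_integrable M (\<lambda>\<omega>. v \<omega> \<bullet> e)"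
    if "square_integrable M v" for v :: "'a \<Rightarrow> 'c" and e
    by (rule square_integrable_linear[OF _ that])
      (simp add: bounded_linear.linear bounded_linear_inner_left)
  have int: "integrable M (\<lambda>\<omega>. (w \<omega> \<bullet> e) * (Z \<omega> \<bullet> e))" for e
    using square_integrable_inner[OF comp[OF w(2)] comp[OF Z], of e e] by simp
  note rce = real_cond_exp_intg[OF int]
  have "(\<integral>\<omega>. w \<omega> \<bullet> vec_cond_exp M F Z \<omega> \<partial>M)
      = (\<integral>\<omega>. (\<Sum>e\<in>Basis. (w \<omega> \<bullet> e) * real_cond_exp M F (\<lambda>\<omega>. Z \<omega> \<bullet> e) \<omega>) \<partial>M)"
    unfolding vec_cond_exp_def by (simp add: inner_sum_right mult.commute)
  also have "\<dots> = (\<Sum>e\<in>Basis. (\<integral>\<omega>. (w \<omega> \<bullet> e) * real_cond_exp M F (\<lambda>\<omega>. Z \<omega> \<bullet> e) \<omega> \<partial>M))"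
    by (rule Bochner_Integration.integral_sum) (rule rce(1); measurable)
  also have "\<dots> = (\<Sum>e\<in>Basis. (\<integral>\<omega>. (w \<omega> \<bullet> e) * (Z \<omega> \<bullet> e) \<partial>M))"
    by (intro sum.cong refl rce(2)) measurable
  also have "\<dots> = (\<integral>\<omega>. (\<Sum>e\<in>Basis. (w \<omega> \<bullet> e) * (Z \<omega> \<bullet> e)) \<partial>M)"
    by (rule Bochner_Integration.integral_sum[symmetric]) (rule int)
  also have "\<dots> = (\<integral>\<omega>. w \<omega> \<bullet> Z \<omega> \<partial>M)"
    by (simp add: euclidean_inner[symmetric])
  finally show ?thesis .
qed

section \<open>The stochastic iteration\<close>

text \<open>\<open>H k\<close> models the history before \<open>G k\<close> is sampled, whence
  \<open>G k\<close> belongs to \<open>H (Suc k)\<close>. Indices \<open>Suc k\<close> encode the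
  steps from 1 on, \<open>\<sigma>\<close> stands for the squared quantity, and
  \<open>\<alpha>_le\<close> is the step size bound without division.\<close>

locale stochastic_primal_dual = primal_dual + prob_space M for M :: "'w measure" +
  fixes H :: "nat \<Rightarrow> 'w measure" and G X Xbar :: "nat \<Rightarrow> 'w \<Rightarrow> 'a"
    and \<Lambda> :: "nat \<Rightarrow> 'w \<Rightarrow> 'b" and \<sigma> :: "nat \<Rightarrow> 'w \<Rightarrow> real"
    and c1 c2 c3 c4 \<kappa> s1 :: real and X0 g0 :: 'a
  assumes filt: "filtration (space M) H"
    and subalg: "subalgebra M (H k)"
    and G_adapted: "G k \<in> borel_measurable (H (Suc k))"
    and \<sigma>_adapted: "\<sigma> (Suc k) \<in> borel_measurable (H (Suc k))"
    and \<sigma>_nonneg: "\<omega> \<in> space M \<Longrightarrow> \<sigma> (Suc k) \<omega> \<ge> 0"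
    and X_init: "\<omega> \<in> space M \<Longrightarrow> X 0 \<omega> = X0"
    and G_init: "\<omega> \<in> space M \<Longrightarrow> G 0 \<omega> = g0"
    and \<sigma>_init: "\<omega> \<in> space M \<Longrightarrow> \<sigma> (Suc 0) \<omega> = s1"
    and run: "\<omega> \<in> space M \<Longrightarrow>
      primal_dual_run \<alpha> R A b Q (\<lambda>k. G k \<omega>) (\<lambda>k. X k \<omega>) (\<lambda>k. Xbar k \<omega>) (\<lambda>k. \<Lambda> k \<omega>)"
    and c_nonneg: "c1 \<ge> 0" "c2 \<ge> 0" "c4 \<ge> 0" and c3: "0 < c3" "c3 \<le> 1"
    and unbiased:
      "AE \<omega> in M. vec_cond_exp M (H (Suc k)) (G (Suc k)) \<omega> = gradient F (X (Suc k) \<omega>)"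
    and second_moment: "AE \<omega> in M.
      nn_cond_exp M (H (Suc k)) (\<lambda>\<omega>. ennreal ((norm (G (Suc k) \<omega> - gradient F Xs))\<^sup>2)) \<omega>
        \<le> ennreal (2 * c1 * bregman F (X (Suc k) \<omega>) Xs + c2 * \<sigma> (Suc k) \<omega>)"
    and \<sigma>_rec: "AE \<omega> in M.
      nn_cond_exp M (H (Suc k)) (\<lambda>\<omega>. ennreal (\<sigma> (Suc (Suc k)) \<omega>)) \<omega>
        \<le> ennreal ((1 - c3) * \<sigma> (Suc k) \<omega> + 2 * c4 * bregman F (X (Suc k) \<omega>) Xs)"
    and \<kappa>_eq: "\<kappa> = c2 / c3"
    and \<alpha>_le: "2 * \<alpha> * (c1 + \<kappa> * c4) \<le> 1"
begin

lemma trajectory: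
  "\<omega> \<in> space M \<Longrightarrow> primal_dual_trajectory F R A b Q L \<alpha> Xs \<Lambda>s
    (\<lambda>k. G k \<omega>) (\<lambda>k. X k \<omega>) (\<lambda>k. Xbar k \<omega>) (\<lambda>k. \<Lambda> k \<omega>)"
  by (intro primal_dual_trajectory.intro primal_dual_trajectory_axioms.intro run)
    (rule primal_dual_axioms)

lemmas Xbar_eq = primal_dual_trajectory.Xbar_eq[OF trajectory]
  and X_Suc = primal_dual_trajectory.X_Suc[OF trajectory]
  and \<Lambda>_Suc = primal_dual_trajectory.\<Lambda>_Suc[OF trajectory]
  and \<Lambda>_0 = primal_dual_trajectory.\<Lambda>_0[OF trajectory]
  and R_Xbar_finite = primal_dual_trajectory.R_Xbar_finite[OF trajectory]
  and lyapunov_Suc = primal_dual_trajectory.lyapunov_Suc[OF trajectory]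
  and lyapunov_0 = primal_dual_trajectory.lyapunov_0[OF trajectory]

section \<open>Measurability and square integrability of the iterates\<close>

lemma H_sigma_finite: "sigma_finite_subalgebra M (H k)"
  by (rule finite_measure_subalgebra_is_sigma_finite) (unfold_locales, rule subalg)

lemma space_H: "space (H k) = space M"
  using subalg[of k] unfolding subalgebra_def by blast

lemma H_mono: "subalgebra (H (Suc k)) (H k)"
  using filtration.sets_F_mono[OF filt, of k "Suc k"] space_H unfolding subalgebra_def by simp

lemma Q_inv_linear: "linear (inv Q)"
  using pos_def_bij[OF Q_pos_def] Q_sa unfolding self_adjoint_def
  by (simp add: bij_is_inj inj_linear_imp_inv_linear linear_linear bij_is_surj)

lemma linear_borel:
  fixes h :: "'c::euclidean_space \<Rightarrow> 'd::euclidean_space"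
  shows "linear h \<Longrightarrow> h \<in> borel_measurable borel"
  by (intro borel_measurable_continuous_onI linear_continuous_on)
    (simp add: linear_conv_bounded_linear)

lemmas [measurable] = linear_borel[OF A_linear] linear_borel[OF At_linear] linear_borel[OF Q_inv_linear]

lemma lipschitz_borel [measurable]:
  "prox \<alpha> R \<in> borel_measurable borel" "gradient F \<in> borel_measurable borel"
  by (rule borel_measurable_continuous_onI lipschitz_on_continuous_on prox_lipschitz F_smooth)+

text \<open>\<open>X (Suc k)\<close> uses estimates up to \<open>G k\<close>, all measurable for
  \<open>H (Suc k)\<close>. So the iterate counts as known when \<open>G (Suc k)\<close> is
  conditioned on \<open>H (Suc k)\<close>.\<close>

lemma iterates_adapted:
  "X k \<in> borel_measurable (H k) \<and> \<Lambda> k \<in> borel_measurable (H k)"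
proof (induction k)
  case 0
  have "X 0 \<in> borel_measurable (H 0) \<longleftrightarrow> (\<lambda>_. X0) \<in> borel_measurable (H 0)"
    by (rule measurable_cong) (simp add: space_H X_init)
  moreover have "\<Lambda> 0 \<in> borel_measurable (H 0) \<longleftrightarrow> (\<lambda>_. 0 :: 'b) \<in> borel_measurable (H 0)"
    by (rule measurable_cong) (simp add: space_H \<Lambda>_0)
  ultimately show ?case by simp
next
  case (Suc k)
  let ?N = "H (Suc k)"
  have [measurable]: "X k \<in> borel_measurable ?N" "\<Lambda> k \<in> borel_measurable ?N"
    using Suc measurable_from_subalg[OF H_mono] by auto
  note [measurable] = G_adapted[of k]
  have "Xbar k \<in> borel_measurable ?N
      \<longleftrightarrow> (\<lambda>\<omega>. prox \<alpha> R (X k \<omega> - \<alpha> *\<^sub>R (At (\<Lambda> k \<omega>) + G k \<omega>))) \<in> borel_measurable ?N"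
    by (rule measurable_cong) (simp add: space_H Xbar_eq)
  then have [measurable]: "Xbar k \<in> borel_measurable ?N" by simp
  have "\<Lambda> (Suc k) \<in> borel_measurable ?N
      \<longleftrightarrow> (\<lambda>\<omega>. \<Lambda> k \<omega> - inv Q (b - A (Xbar k \<omega>))) \<in> borel_measurable ?N"
    by (rule measurable_cong) (simp add: space_H \<Lambda>_Suc)
  then have [measurable]: "\<Lambda> (Suc k) \<in> borel_measurable ?N" by simp
  have "X (Suc k) \<in> borel_measurable ?N
      \<longleftrightarrow> (\<lambda>\<omega>. Xbar k \<omega> + \<alpha> *\<^sub>R At (\<Lambda> k \<omega> - \<Lambda> (Suc k) \<omega>)) \<in> borel_measurable ?N"
    by (rule measurable_cong) (simp add: space_H X_Suc)
  then show ?case by simp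
qed

lemma iteration_square_integrable:
  assumes X: "square_integrable M (X k)" and \<Lambda>: "square_integrable M (\<Lambda> k)"
    and G: "square_integrable M (G k)"
  shows "square_integrable M (Xbar k)" "square_integrable M (\<Lambda> (Suc k))"
    "square_integrable M (X (Suc k))"
proof -
  have "square_integrable M (\<lambda>\<omega>. prox \<alpha> R (X k \<omega> - \<alpha> *\<^sub>R (At (\<Lambda> k \<omega>) + G k \<omega>)))"
    by (intro square_integrable_lipschitz[OF prox_lipschitz] square_integrable_diff
        square_integrable_scaleR square_integrable_add square_integrable_linear[OF At_linear]
        X \<Lambda> G)
  then show Xb: "square_integrable M (Xbar k)"
    by (subst square_integrable_cong[OF Xbar_eq])
  have "square_integrable M (\<lambda>\<omega>. \<Lambda> k \<omega> - inv Q (b - A (Xbar k \<omega>)))"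
    by (intro square_integrable_diff square_integrable_linear[OF Q_inv_linear]
        square_integrable_linear[OF A_linear] square_integrable_const Xb \<Lambda>)
  then show \<Lambda>': "square_integrable M (\<Lambda> (Suc k))"
    by (subst square_integrable_cong[OF \<Lambda>_Suc])
  have "square_integrable M (\<lambda>\<omega>. Xbar k \<omega> + \<alpha> *\<^sub>R At (\<Lambda> k \<omega> - \<Lambda> (Suc k) \<omega>))"
    by (intro square_integrable_diff square_integrable_linear[OF At_linear]
        square_integrable_scaleR square_integrable_add Xb \<Lambda> \<Lambda>')
  then show "square_integrable M (X (Suc k))"
    by (subst square_integrable_cong[OF X_Suc])
qed

lemma bregman_borel [measurable]: "(\<lambda>x. bregman F x Xs) \<in> borel_measurable borel"
proof (rule borel_measurable_continuous_onI)
  have "isCont F x" for x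
    using F_gderiv[of x] unfolding gderiv_def by (rule has_derivative_continuous)
  then have "continuous_on UNIV F" by (simp add: continuous_at_imp_continuous_on)
  then show "continuous_on UNIV (\<lambda>x. bregman F x Xs)"
    unfolding bregman_def by (intro continuous_intros)
qed

lemma gradient_inner_integrable:
  assumes "square_integrable M v"
  shows "integrable M (\<lambda>\<omega>. (v \<omega> - Xs) \<bullet> (gradient F (v \<omega>) - gradient F Xs))"
  by (intro square_integrable_inner square_integrable_diff square_integrable_const
      square_integrable_lipschitz[OF F_smooth] assms)

lemma bregman_integrable:
  assumes "square_integrable M v"
  shows "integrable M (\<lambda>\<omega>. bregman F (v \<omega>) Xs)"
proof (rule Bochner_Integration.integrable_bound[OF gradient_inner_integrable[OF assms]])
  note [measurable] = square_integrableD(1)[OF assms]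
  show "(\<lambda>\<omega>. bregman F (v \<omega>) Xs) \<in> borel_measurable M" by measurable
  show "AE \<omega> in M. norm (bregman F (v \<omega>) Xs)
      \<le> norm ((v \<omega> - Xs) \<bullet> (gradient F (v \<omega>) - gradient F Xs))"
    using bregman_nonneg bregman_le order_trans[OF bregman_nonneg bregman_le] by simp
qed

text \<open>Finiteness of the second moment comes from the conditional bound, whose right-hand side
  is already integrable.\<close>

lemma gradient_estimate_moment:
  assumes X: "square_integrable M (X (Suc k))" and \<sigma>: "integrable M (\<sigma> (Suc k))"
  shows "square_integrable M (G (Suc k))"
    and "expectation (\<lambda>\<omega>. (norm (G (Suc k) \<omega> - gradient F Xs))\<^sup>2)
      \<le> 2 * c1 * expectation (\<lambda>\<omega>. bregman F (X (Suc k) \<omega>) Xs) + c2 * expectation (\<sigma> (Suc k))"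
proof -
  let ?r = "\<lambda>\<omega>. 2 * c1 * bregman F (X (Suc k) \<omega>) Xs + c2 * \<sigma> (Suc k) \<omega>"
  interpret S: sigma_finite_subalgebra M "H (Suc k)" by (rule H_sigma_finite)
  have [measurable]: "G (Suc k) \<in> borel_measurable M"
    by (rule measurable_from_subalg[OF subalg G_adapted])
  have meas: "(\<lambda>\<omega>. (norm (G (Suc k) \<omega> - gradient F Xs))\<^sup>2) \<in> borel_measurable M" by measurable
  have r: "integrable M ?r" using bregman_integrable[OF X] \<sigma> by simp
  have r0: "0 \<le> ?r \<omega>" if "\<omega> \<in> space M" for \<omega>
    using bregman_nonneg \<sigma>_nonneg[OF that] c_nonneg by simp
  note * = S.integral_le_of_nn_cond_exp_le[OF meas r _ r0 second_moment]
  have "square_integrable M (\<lambda>\<omega>. G (Suc k) \<omega> - gradient F Xs)"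
    unfolding square_integrable_def using *(1) by simp
  from square_integrable_add[OF this square_integrable_const[of "gradient F Xs"]]
  show "square_integrable M (G (Suc k))" by simp
  show "expectation (\<lambda>\<omega>. (norm (G (Suc k) \<omega> - gradient F Xs))\<^sup>2)
      \<le> 2 * c1 * expectation (\<lambda>\<omega>. bregman F (X (Suc k) \<omega>) Xs) + c2 * expectation (\<sigma> (Suc k))"
    using *(2) bregman_integrable[OF X] \<sigma> by simp
qed

lemma variance_proxy_step:
  assumes X: "square_integrable M (X (Suc k))" and \<sigma>: "integrable M (\<sigma> (Suc k))"
  shows "integrable M (\<sigma> (Suc (Suc k)))"
    and "expectation (\<sigma> (Suc (Suc k)))
      \<le> (1 - c3) * expectation (\<sigma> (Suc k)) + 2 * c4 * expectation (\<lambda>\<omega>. bregman F (X (Suc k) \<omega>) Xs)"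
proof -
  let ?r = "\<lambda>\<omega>. (1 - c3) * \<sigma> (Suc k) \<omega> + 2 * c4 * bregman F (X (Suc k) \<omega>) Xs"
  interpret S: sigma_finite_subalgebra M "H (Suc k)" by (rule H_sigma_finite)
  have meas: "\<sigma> (Suc (Suc k)) \<in> borel_measurable M"
    by (rule measurable_from_subalg[OF subalg \<sigma>_adapted])
  have r: "integrable M ?r" using bregman_integrable[OF X] \<sigma> by simp
  have r0: "0 \<le> ?r \<omega>" if "\<omega> \<in> space M" for \<omega>
    using bregman_nonneg \<sigma>_nonneg[OF that] c_nonneg c3 by simp
  note * = S.integral_le_of_nn_cond_exp_le[OF meas r \<sigma>_nonneg r0 \<sigma>_rec]
  show "integrable M (\<sigma> (Suc (Suc k)))" by (rule *(1))
  show "expectation (\<sigma> (Suc (Suc k)))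
      \<le> (1 - c3) * expectation (\<sigma> (Suc k)) + 2 * c4 * expectation (\<lambda>\<omega>. bregman F (X (Suc k) \<omega>) Xs)"
    using *(2) bregman_integrable[OF X] \<sigma> by simp
qed

text \<open>The claims feed one another: step \<open>k\<close> controls \<open>X (Suc k)\<close>,
  which together with \<open>\<sigma> (Suc k)\<close> controls \<open>G (Suc k)\<close> and the next
  \<open>\<sigma>\<close>. The start is deterministic.\<close>

lemma square_integrable_iterates:
  "square_integrable M (X k) \<and> square_integrable M (\<Lambda> k) \<and> square_integrable M (G k)
    \<and> integrable M (\<sigma> (Suc k))"
proof (induction k)
  case 0
  have "square_integrable M (X 0)"
    by (subst square_integrable_cong[OF X_init], assumption, rule square_integrable_const)
  moreover have "square_integrable M (\<Lambda> 0)"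
    by (subst square_integrable_cong[OF \<Lambda>_0], assumption, rule square_integrable_const)
  moreover have "square_integrable M (G 0)"
    by (subst square_integrable_cong[OF G_init], assumption, rule square_integrable_const)
  moreover have "integrable M (\<sigma> (Suc 0)) \<longleftrightarrow> integrable M (\<lambda>_. s1)"
    by (rule Bochner_Integration.integrable_cong) (simp_all add: \<sigma>_init)
  ultimately show ?case by simp
next
  case (Suc k)
  then have "square_integrable M (X (Suc k))" "square_integrable M (\<Lambda> (Suc k))"
    using iteration_square_integrable by blast+
  then show ?case
    using Suc gradient_estimate_moment(1) variance_proxy_step(1) by blast
qed

lemma
  shows X_square_integrable: "square_integrable M (X k)"
    and \<Lambda>_square_integrable: "square_integrable M (\<Lambda> k)"
    and G_square_integrable: "square_integrable M (G k)"
    and \<sigma>_integrable: "integrable M (\<sigma> (Suc k))"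
    and Xbar_square_integrable: "square_integrable M (Xbar k)"
  using square_integrable_iterates[of k] iteration_square_integrable(1) by auto

section \<open>Expected decrease of the potential\<close>

lemma lyapunov_integrable: "integrable M (\<lambda>\<omega>. lyapunov (Xbar k \<omega>) (\<Lambda> k \<omega>))"
proof -
  have J: "linear J" using J_pos_def unfolding pos_def_def self_adjoint_def by blast
  have "square_integrable M (\<lambda>\<omega>. Xbar k \<omega> + \<alpha> *\<^sub>R At (\<Lambda> k \<omega>) - (\<alpha> *\<^sub>R At \<Lambda>s + Xs))"
    by (intro square_integrable_diff square_integrable_add square_integrable_scaleR
        square_integrable_linear[OF At_linear] square_integrable_const
        Xbar_square_integrable \<Lambda>_square_integrable)
  moreover have "integrable M (\<lambda>\<omega>. (\<Lambda> k \<omega> - \<Lambda>s) \<bullet> J (\<Lambda> k \<omega> - \<Lambda>s))"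
    by (intro square_integrable_inner square_integrable_linear[OF J] square_integrable_diff
        \<Lambda>_square_integrable square_integrable_const)
  ultimately show ?thesis
    unfolding lyapunov_def weighted_norm_sq_def square_integrable_def by simp
qed

text \<open>The deviation of \<open>X (Suc k)\<close> is measurable for the history, so the estimate
  may be replaced by its conditional mean; the constant gradient at \<open>Xs\<close> contributes
  equally to both sides.\<close>

lemma unbiased_inner:
  "expectation (\<lambda>\<omega>. (X (Suc k) \<omega> - Xs) \<bullet> (G (Suc k) \<omega> - gradient F Xs))
    = expectation (\<lambda>\<omega>. (X (Suc k) \<omega> - Xs) \<bullet> (gradient F (X (Suc k) \<omega>) - gradient F Xs))"
proof -
  interpret S: sigma_finite_subalgebra M "H (Suc k)" by (rule H_sigma_finite)
  let ?x = "\<lambda>\<omega>. X (Suc k) \<omega> - Xs"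
  note [measurable] = conjunct1[OF iterates_adapted, of "Suc k"]
    square_integrableD(1)[OF X_square_integrable, of "Suc k"]
  have x_H: "?x \<in> borel_measurable (H (Suc k))" by measurable
  have x: "square_integrable M ?x"
    by (intro square_integrable_diff X_square_integrable square_integrable_const)
  have grad: "square_integrable M (\<lambda>\<omega>. gradient F (X (Suc k) \<omega>))"
    by (intro square_integrable_lipschitz[OF F_smooth] X_square_integrable)
  note int = square_integrable_inner[OF x G_square_integrable[of "Suc k"]]
    square_integrable_inner[OF x grad]
    square_integrable_inner[OF x square_integrable_const[of "gradient F Xs"]]
  have "expectation (\<lambda>\<omega>. ?x \<omega> \<bullet> G (Suc k) \<omega>)
      = expectation (\<lambda>\<omega>. ?x \<omega> \<bullet> vec_cond_exp M (H (Suc k)) (G (Suc k)) \<omega>)"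
    by (rule S.integral_inner_vec_cond_exp[symmetric, OF finite_measure_axioms x_H x
          G_square_integrable])
  also have "\<dots> = expectation (\<lambda>\<omega>. ?x \<omega> \<bullet> gradient F (X (Suc k) \<omega>))"
  proof (rule integral_cong_AE)
    show "AE \<omega> in M. ?x \<omega> \<bullet> vec_cond_exp M (H (Suc k)) (G (Suc k)) \<omega>
        = ?x \<omega> \<bullet> gradient F (X (Suc k) \<omega>)"
      using unbiased[of k] by eventually_elim simp
    have [measurable]: "vec_cond_exp M (H (Suc k)) (G (Suc k)) \<in> borel_measurable M"
      unfolding vec_cond_exp_def[abs_def] by measurable
    show "(\<lambda>\<omega>. ?x \<omega> \<bullet> vec_cond_exp M (H (Suc k)) (G (Suc k)) \<omega>) \<in> borel_measurable M"
      by measurable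
  qed measurable
  finally show ?thesis using int by (simp add: inner_diff_right)
qed

text \<open>The index of \<open>\<sigma>\<close> is one ahead because the next step samples
  \<open>G (Suc k)\<close>, whose second moment involves \<open>\<sigma> (Suc k)\<close>.\<close>

definition "potential k \<omega> = lyapunov (Xbar k \<omega>) (\<Lambda> k \<omega>) + \<kappa> * \<alpha>\<^sup>2 * \<sigma> (Suc k) \<omega>"

lemma \<kappa>_nonneg: "\<kappa> \<ge> 0"
  using c_nonneg c3 by (simp add: \<kappa>_eq)

lemma potential_nonneg: "\<omega> \<in> space M \<Longrightarrow> 0 \<le> potential k \<omega>"
  unfolding potential_def using lyapunov_nonneg \<sigma>_nonneg \<kappa>_nonneg by simp

lemma R_borel [measurable]: "R \<in> borel_measurable borel"
  using R_pcc closed_epigraph_borel unfolding proper_closed_convex_def by blast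

lemma DR_borel [measurable]: "DR \<in> borel_measurable borel"
  unfolding DR_def[abs_def] bregman_sub_def by measurable

text \<open>Solving the Lyapunov inequality for \<open>DR\<close> and dropping the new, nonnegative
  Lyapunov value leaves an integrable majorant.\<close>

lemma DR_integrable: "integrable M (\<lambda>\<omega>. DR (Xbar (Suc k) \<omega>))"
proof -
  let ?h = "\<lambda>\<omega>. lyapunov (Xbar k \<omega>) (\<Lambda> k \<omega>)
    - 2 * \<alpha> * ((X (Suc k) \<omega> - Xs) \<bullet> (G (Suc k) \<omega> - gradient F Xs))
    + \<alpha>\<^sup>2 * (norm (G (Suc k) \<omega> - gradient F Xs))\<^sup>2"
  note [measurable] = square_integrableD(1)[OF Xbar_square_integrable]
  have g: "square_integrable M (\<lambda>\<omega>. G (Suc k) \<omega> - gradient F Xs)"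
    by (intro square_integrable_diff G_square_integrable square_integrable_const)
  have "integrable M (\<lambda>\<omega>. (X (Suc k) \<omega> - Xs) \<bullet> (G (Suc k) \<omega> - gradient F Xs))"
    by (intro square_integrable_inner g square_integrable_diff X_square_integrable
        square_integrable_const)
  then have "integrable M ?h"
    using lyapunov_integrable[of k] square_integrableD(2)[OF g] by simp
  then have "integrable M (\<lambda>\<omega>. 1 / (2 * \<alpha>) * ?h \<omega>)" by (rule integrable_mult_right)
  then show ?thesis
  proof (rule Bochner_Integration.integrable_bound)
    show "(\<lambda>\<omega>. DR (Xbar (Suc k) \<omega>)) \<in> borel_measurable M" by measurable
    show "AE \<omega> in M. norm (DR (Xbar (Suc k) \<omega>)) \<le> norm (1 / (2 * \<alpha>) * ?h \<omega>)"
    proof (rule AE_I2)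
      fix \<omega> assume \<omega>: "\<omega> \<in> space M"
      have "2 * \<alpha> * DR (Xbar (Suc k) \<omega>) \<le> ?h \<omega>"
        using lyapunov_Suc[OF \<omega>, of k] lyapunov_nonneg[of "Xbar (Suc k) \<omega>" "\<Lambda> (Suc k) \<omega>"]
        by linarith
      then have "DR (Xbar (Suc k) \<omega>) \<le> 1 / (2 * \<alpha>) * ?h \<omega>"
        using \<alpha>_pos by (simp add: field_simps)
      then show "norm (DR (Xbar (Suc k) \<omega>)) \<le> norm (1 / (2 * \<alpha>) * ?h \<omega>)"
        using DR_nonneg[OF R_Xbar_finite[OF \<omega>, of "Suc k"]] by (simp only: real_norm_def abs_of_nonneg)
    qed
  qed
qed

text \<open>The weight \<open>\<kappa> * \<alpha>\<^sup>2\<close> makes the contraction of \<open>\<sigma>\<close> absorb the term \<open>c2 * \<sigma>\<close> of the second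
  moment, because \<open>\<kappa> * c3 = c2\<close>.\<close>

lemma expected_descent:
  "\<alpha> * expectation (\<lambda>\<omega>. bregman F (X (Suc k) \<omega>) Xs + DR (Xbar (Suc k) \<omega>))
    \<le> expectation (potential k) - expectation (potential (Suc k))"
proof -
  let ?x = "\<lambda>\<omega>. X (Suc k) \<omega> - Xs" and ?g = "\<lambda>\<omega>. G (Suc k) \<omega> - gradient F Xs"
  let ?V = "\<lambda>k \<omega>. lyapunov (Xbar k \<omega>) (\<Lambda> k \<omega>)"
  let ?DR = "\<lambda>\<omega>. DR (Xbar (Suc k) \<omega>)"
  define DF where "DF = expectation (\<lambda>\<omega>. bregman F (X (Suc k) \<omega>) Xs)"
  define S where "S = expectation (\<sigma> (Suc k))"
  note X = X_square_integrable[of "Suc k"] and \<sigma> = \<sigma>_integrable[of k]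
  have g: "square_integrable M ?g"
    by (intro square_integrable_diff G_square_integrable square_integrable_const)
  have xg: "integrable M (\<lambda>\<omega>. ?x \<omega> \<bullet> ?g \<omega>)"
    by (intro square_integrable_inner g square_integrable_diff X square_integrable_const)
  note int = lyapunov_integrable xg DR_integrable square_integrableD(2)[OF g]
  have "expectation (?V (Suc k)) \<le> expectation
      (\<lambda>\<omega>. ?V k \<omega> - 2 * \<alpha> * (?x \<omega> \<bullet> ?g \<omega>) - 2 * \<alpha> * ?DR \<omega> + \<alpha>\<^sup>2 * (norm (?g \<omega>))\<^sup>2)"
    by (rule integral_mono) (use int lyapunov_Suc in auto)
  also have "\<dots> = expectation (?V k) - 2 * \<alpha> * expectation (\<lambda>\<omega>. ?x \<omega> \<bullet> ?g \<omega>)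
      - 2 * \<alpha> * expectation ?DR + \<alpha>\<^sup>2 * expectation (\<lambda>\<omega>. (norm (?g \<omega>))\<^sup>2)"
    using int by simp
  finally have V: "expectation (?V (Suc k)) \<le> \<dots>" .
  \<comment> \<open>Unbiasedness replaces the estimate by the true gradient, after which convexity
    applies pointwise.\<close>
  have DF_le: "DF \<le> expectation (\<lambda>\<omega>. ?x \<omega> \<bullet> ?g \<omega>)"
    unfolding DF_def unbiased_inner
    by (rule integral_mono) (use bregman_integrable[OF X] gradient_inner_integrable[OF X] bregman_le in auto)
  then have DF_le': "2 * \<alpha> * DF \<le> 2 * \<alpha> * expectation (\<lambda>\<omega>. ?x \<omega> \<bullet> ?g \<omega>)"
    using \<alpha>_pos by simp
  have g_le: "\<alpha>\<^sup>2 * expectation (\<lambda>\<omega>. (norm (?g \<omega>))\<^sup>2) \<le> \<alpha>\<^sup>2 * (2 * c1 * DF + c2 * S)"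
    unfolding DF_def S_def by (intro mult_left_mono gradient_estimate_moment(2) X \<sigma>) simp
  have s_le: "\<kappa> * \<alpha>\<^sup>2 * expectation (\<sigma> (Suc (Suc k))) \<le> \<kappa> * \<alpha>\<^sup>2 * ((1 - c3) * S + 2 * c4 * DF)"
    unfolding DF_def S_def
    by (intro mult_left_mono variance_proxy_step(2) X \<sigma>) (use \<kappa>_nonneg in simp)
  \<comment> \<open>The step size condition spends at most half of the gain
    \<open>2 * \<alpha> * DF\<close> on the noise terms; the claim keeps the other half.\<close>
  have "0 \<le> DF" unfolding DF_def by (simp add: bregman_nonneg)
  then have "\<alpha> * (2 * \<alpha> * (c1 + \<kappa> * c4)) * DF \<le> \<alpha> * 1 * DF"
    using \<alpha>_le \<alpha>_pos by (intro mult_right_mono mult_left_mono) auto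
  then have step: "\<alpha>\<^sup>2 * (2 * c1 * DF) + \<kappa> * \<alpha>\<^sup>2 * (2 * c4 * DF) \<le> \<alpha> * DF"
    by (simp add: algebra_simps power2_eq_square)
  have "\<kappa> * c3 = c2" using c3 by (simp add: \<kappa>_eq)
  then have absorb: "\<kappa> * \<alpha>\<^sup>2 * ((1 - c3) * S) = \<kappa> * \<alpha>\<^sup>2 * S - \<alpha>\<^sup>2 * (c2 * S)"
    by (auto simp: algebra_simps)
  \<comment> \<open>The descent provides \<open>2 * \<alpha>\<close> times this expectation while
    the claim asks for \<open>\<alpha>\<close> times it; nonnegativity discards the surplus.\<close>
  have "0 \<le> expectation ?DR"
    by (rule Bochner_Integration.integral_nonneg) (rule DR_nonneg[OF R_Xbar_finite])
  then have DR0: "0 \<le> \<alpha> * expectation ?DR" using \<alpha>_pos by simp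
  have pot: "expectation (potential j) = expectation (?V j) + \<kappa> * \<alpha>\<^sup>2 * expectation (\<sigma> (Suc j))" for j
    unfolding potential_def[abs_def] using lyapunov_integrable \<sigma>_integrable by simp
  have "expectation (\<lambda>\<omega>. bregman F (X (Suc k) \<omega>) Xs + ?DR \<omega>) = DF + expectation ?DR"
    unfolding DF_def using bregman_integrable[OF X] DR_integrable by simp
  then show ?thesis
    unfolding pot using V DF_le' g_le s_le step absorb DR0
    by (simp add: distrib_left S_def)
qed

lemma expected_gap_sum:
  "\<alpha> * (\<Sum>k<K. expectation (\<lambda>\<omega>. bregman F (X (Suc k) \<omega>) Xs + DR (Xbar (Suc k) \<omega>)))
    \<le> expectation (potential 0)"
proof -
  have "\<alpha> * (\<Sum>k<K. expectation (\<lambda>\<omega>. bregman F (X (Suc k) \<omega>) Xs + DR (Xbar (Suc k) \<omega>)))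
      \<le> (\<Sum>k<K. expectation (potential k) - expectation (potential (Suc k)))"
    unfolding sum_distrib_left by (intro sum_mono expected_descent)
  also have "\<dots> = expectation (potential 0) - expectation (potential K)"
    by (rule sum_lessThan_telescope')
  also have "\<dots> \<le> expectation (potential 0)"
    by (simp add: Bochner_Integration.integral_nonneg potential_nonneg)
  finally show ?thesis .
qed

section \<open>Averaged iterates and the final estimate\<close>

definition "gap K \<omega> = ereal (bregman F ((1 / real K) *\<^sub>R (\<Sum>k<K. X (Suc k) \<omega>)) Xs)
  + bregman_sub R \<theta>s ((1 / real K) *\<^sub>R (\<Sum>k<K. Xbar (Suc k) \<omega>)) Xs"

lemma gap_measurable: "gap K \<in> borel_measurable M"
proof -
  note [measurable] = square_integrableD(1)[OF Xbar_square_integrable]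
    square_integrableD(1)[OF X_square_integrable]
  show ?thesis unfolding gap_def[abs_def] bregman_sub_def by measurable
qed

text \<open>Jensen's inequality with uniform weights for both divergences; convexity also keeps
  \<open>R\<close> finite at the average, so the gap is real.\<close>

lemma gap_le:
  assumes \<omega>: "\<omega> \<in> space M" and K: "K \<ge> 1"
  shows "gap K \<omega> \<le> ereal (1 / real K *
    (\<Sum>k<K. bregman F (X (Suc k) \<omega>) Xs + DR (Xbar (Suc k) \<omega>)))"
proof -
  let ?w = "\<lambda>_::nat. 1 / real K"
  have w: "sum ?w {..<K} = 1" using K by simp
  have fin: "\<bar>R (Xbar (Suc k) \<omega>)\<bar> \<noteq> \<infinity>" for k by (rule R_Xbar_finite[OF \<omega>])
  have "bregman F (\<Sum>k<K. ?w k *\<^sub>R X (Suc k) \<omega>) Xs \<le> (\<Sum>k<K. ?w k * bregman F (X (Suc k) \<omega>) Xs)"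
    by (rule bregman_convex_sum[OF _ w]) auto
  moreover note DR_convex_sum[of "{..<K}" ?w "\<lambda>k. Xbar (Suc k) \<omega>", OF _ w _ fin]
  ultimately show ?thesis
    unfolding gap_def
    by (simp add: bregman_sub_finite scaleR_sum_right sum_distrib_left distrib_left sum.distrib
        del: sum_divide_distrib[symmetric])
qed

theorem expected_gap:
  assumes K: "K \<ge> 1" and Y: "\<And>\<omega>. \<omega> \<in> space M \<Longrightarrow> Xbar 0 \<omega> = Y"
  shows "(\<integral>\<^sup>+ \<omega>. e2ennreal (gap K \<omega>) \<partial>M)
    \<le> ennreal (((norm (Y - (\<alpha> *\<^sub>R At \<Lambda>s + Xs)))\<^sup>2 + weighted_norm_sq (\<lambda>v. \<alpha> *\<^sub>R J v) \<Lambda>s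
        + \<kappa> * \<alpha>\<^sup>2 * s1) / (\<alpha> * real K))" (is "_ \<le> ennreal (?C / _)")
proof -
  let ?f = "\<lambda>k \<omega>. bregman F (X (Suc k) \<omega>) Xs + DR (Xbar (Suc k) \<omega>)"
  let ?h = "\<lambda>\<omega>. 1 / real K * (\<Sum>k<K. ?f k \<omega>)"
  have f: "integrable M (?f k)" for k
    using bregman_integrable[OF X_square_integrable] DR_integrable by simp
  have f0: "0 \<le> ?f k \<omega>" if "\<omega> \<in> space M" for k \<omega>
    using bregman_nonneg DR_nonneg[OF R_Xbar_finite[OF that]] by simp
  have h: "integrable M ?h" by (intro integrable_mult_right Bochner_Integration.integrable_sum f)
  \<comment> \<open>At index 0 all quantities are deterministic, so the expectation is the initial
    value.\<close>
  have "expectation (potential 0) = expectation (\<lambda>_. ?C)"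
  proof (rule Bochner_Integration.integral_cong[OF refl])
    fix \<omega> assume \<omega>: "\<omega> \<in> space M"
    show "potential 0 \<omega> = ?C"
      unfolding potential_def using lyapunov_0[OF \<omega>] by (simp add: Y[OF \<omega>] \<sigma>_init[OF \<omega>])
  qed
  then have pot0: "expectation (potential 0) = ?C" by (simp add: prob_space)
  have "expectation ?h = 1 / real K * (\<Sum>k<K. expectation (?f k))"
    using f by (simp add: Bochner_Integration.integral_sum)
  also have "\<dots> \<le> ?C / (\<alpha> * real K)"
    using expected_gap_sum[of K] K \<alpha>_pos unfolding pot0 by (simp add: field_simps)
  finally have Eh: "expectation ?h \<le> ?C / (\<alpha> * real K)" .
  have "(\<integral>\<^sup>+ \<omega>. e2ennreal (gap K \<omega>) \<partial>M) \<le> (\<integral>\<^sup>+ \<omega>. ennreal (?h \<omega>) \<partial>M)"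
  proof (rule nn_integral_mono)
    fix \<omega> assume "\<omega> \<in> space M"
    then show "e2ennreal (gap K \<omega>) \<le> ennreal (?h \<omega>)"
      using e2ennreal_mono[OF gap_le[OF _ K]] by (simp add: e2ennreal_ereal)
  qed
  also have "\<dots> = ennreal (expectation ?h)"
    by (rule nn_integral_eq_integral[OF h]) (use f0 in \<open>auto intro!: sum_nonneg divide_nonneg_nonneg\<close>)
  also have "\<dots> \<le> ennreal (?C / (\<alpha> * real K))" using Eh by (rule ennreal_leI)
  finally show ?thesis .
qed

end

section \<open>The lifted problem\<close>

text \<open>Riesz representation: the functional \<open>h'\<close> is the inner product with
  \<open>adjoint h' 1\<close>.\<close>

lemma differentiable_GDERIV:
  fixes h :: "'a::euclidean_space \<Rightarrow> real"
  assumes "h differentiable (at x)"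
  shows "GDERIV h x :> gradient h x"
proof -
  obtain h' where h': "(h has_derivative h') (at x)"
    using assms unfolding differentiable_def by blast
  have "u \<bullet> adjoint h' 1 = h' u" for u
    using adjoint_works[OF has_derivative_linear[OF h'], of u 1] by simp
  then have "GDERIV h x :> adjoint h' 1" using h' unfolding gderiv_def by simp
  then show ?thesis using gradient_eqI[of h x] by metis
qed

lemma lift_F_GDERIV:
  assumes "f differentiable (at (fst X))"
  shows "GDERIV (lift_F f) X :> (gradient f (fst X), 0)"
proof -
  have "(fst has_derivative fst) (at X)"
    by (intro bounded_linear_imp_has_derivative bounded_linear_fst)
  from has_derivative_compose[OF this differentiable_GDERIV[OF assms, unfolded gderiv_def]]
  show ?thesis
    unfolding gderiv_def lift_F_def[abs_def] by (simp add: inner_prod_def)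
qed

lemma lift_F_gradient:
  "f differentiable (at (fst X)) \<Longrightarrow> gradient (lift_F f) X = (gradient f (fst X), 0)"
  by (rule gradient_eqI[OF lift_F_GDERIV])

lemma lift_F_convex: "convex_on UNIV f \<Longrightarrow> convex_on UNIV (lift_F f)"
  unfolding convex_on_def lift_F_def by simp

lemma lift_F_smooth:
  assumes "L-lipschitz_on UNIV (gradient f)" and "\<And>x. f differentiable (at x)"
  shows "L-lipschitz_on UNIV (gradient (lift_F f))"
proof (rule lipschitz_onI)
  fix X Y :: "(real^'a) \<times> (real^'b)"
  have "dist (gradient (lift_F f) X) (gradient (lift_F f) Y) \<le> L * dist (fst X) (fst Y)"
    using lipschitz_onD[OF assms(1)] by (simp add: lift_F_gradient assms(2) dist_Pair_Pair)
  also have "\<dots> \<le> L * dist X Y"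
    by (intro mult_left_mono dist_fst_le lipschitz_on_nonneg[OF assms(1)])
  finally show "dist (gradient (lift_F f) X) (gradient (lift_F f) Y) \<le> L * dist X Y" .
qed (rule lipschitz_on_nonneg[OF assms(1)])

text \<open>The lifted epigraph is the preimage of the given one under a continuous linear
  projection, which preserves closedness and convexity.\<close>

lemma lift_R_pcc:
  fixes r :: "real^'p1 \<Rightarrow> ereal"
  assumes "proper_closed_convex r"
  shows "proper_closed_convex (lift_R r :: (real^'n) \<times> (real^'p1) \<Rightarrow> ereal)"
proof -
  let ?p = "\<lambda>z :: ((real^'n) \<times> (real^'p1)) \<times> real. (snd (fst z), snd z)"
  have epi: "ereal_epigraph (lift_R r) = ?p -` ereal_epigraph r"
    unfolding ereal_epigraph_def lift_R_def by auto
  have "linear ?p" by (intro linearI) auto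
  then show ?thesis
    using assms unfolding proper_closed_convex_def epi
    by (auto simp: lift_R_def intro!: closed_vimage convex_linear_vimage continuous_intros)
qed

lemma lift_D_linear: "linear (lift_D B D)"
  by (intro linearI)
    (auto simp: lift_D_def matrix_vector_right_distrib matrix_vector_mult_scaleR scaleR_diff_right)

text \<open>The gap is extended-valued because \<open>R\<close> is. Both divergences are nonnegative
  at these averages, so \<open>e2ennreal\<close> loses nothing, and the bound includes finiteness of
  the expectation.\<close>

theorem theorem4:
  fixes fs :: "nat \<Rightarrow> real^'n \<Rightarrow> real" and m :: nat and f :: "real^'n \<Rightarrow> real" and L :: real
    and r :: "real^'p1 \<Rightarrow> ereal"
    and B :: "real^'n^'p1" and D :: "real^'n^'p2" and d :: "real^'p2"
    and F :: "(real^'n) \<times> (real^'p1) \<Rightarrow> real" and R :: "(real^'n) \<times> (real^'p1) \<Rightarrow> ereal"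
    and DD :: "(real^'n) \<times> (real^'p1) \<Rightarrow> (real^'p2) \<times> (real^'p1)" and dd :: "(real^'p2) \<times> (real^'p1)"
    and Q J :: "(real^'p2) \<times> (real^'p1) \<Rightarrow> (real^'p2) \<times> (real^'p1)"
    and Xs :: "(real^'n) \<times> (real^'p1)" and \<Lambda>s :: "(real^'p2) \<times> (real^'p1)"
    and \<alpha> c1 c2 c3 c4 \<kappa> s1 :: real and K :: nat
    and X0 Xbar0 :: "(real^'n) \<times> (real^'p1)" and g0 :: "real^'n"
    and M :: "'w measure" and H :: "nat \<Rightarrow> 'w measure"
    and g :: "nat \<Rightarrow> 'w \<Rightarrow> real^'n" and G :: "nat \<Rightarrow> 'w \<Rightarrow> (real^'n) \<times> (real^'p1)"
    and X Xbar :: "nat \<Rightarrow> 'w \<Rightarrow> (real^'n) \<times> (real^'p1)"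
    and \<Lambda> :: "nat \<Rightarrow> 'w \<Rightarrow> (real^'p2) \<times> (real^'p1)"
    and \<sigma>sq :: "nat \<Rightarrow> 'w \<Rightarrow> real"
    and XK XtK :: "'w \<Rightarrow> (real^'n) \<times> (real^'p1)"
  assumes f_sum: "f = (\<lambda>x. \<Sum>i=1..m. fs i x)"
    and f_convex: "convex_on UNIV f"
    and f_diff: "\<forall>x. f differentiable (at x)"
    and L_pos: "L > 0"
    and f_smooth: "L-lipschitz_on UNIV (gradient f)"
    and r_pcc: "proper_closed_convex r"
    and solvable: "solution_set (problem_objective f r B D d) \<noteq> {}"
    and F_eq: "F = lift_F f"
    and R_eq: "R = lift_R r"
    and DD_eq: "DD = lift_D B D"
    and dd_eq: "dd = lift_d d"
    and Q_sa: "self_adjoint Q"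
    and J_eq: "J = (\<lambda>v. Q v - \<alpha> *\<^sub>R DD (adjoint DD v))"
    and saddle: "(Xs, \<Lambda>s) \<in> saddle_points (lagrangian F R DD dd)"
    and prob: "prob_space M"
    and filt: "filtration (space M) H"
    and subalg: "\<forall>k. subalgebra M (H k)"
    and g_adapted: "\<forall>k. g k \<in> borel_measurable (H (Suc k))"
    and G_eq: "\<forall>k. G k = (\<lambda>\<omega>. (g k \<omega>, 0))"
    and \<sigma>_adapted: "\<forall>k\<ge>1. \<sigma>sq k \<in> borel_measurable (H k)"
    and \<sigma>_nonneg: "\<forall>k\<ge>1. \<forall>\<omega>\<in>space M. \<sigma>sq k \<omega> \<ge> 0"
    and X_init: "\<forall>\<omega>\<in>space M. X 0 \<omega> = X0"
    and g_init: "\<forall>\<omega>\<in>space M. g 0 \<omega> = g0"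
    and \<sigma>_init: "\<forall>\<omega>\<in>space M. \<sigma>sq 1 \<omega> = s1"
    and Xbar0_eq: "Xbar0 = prox \<alpha> R (X0 - \<alpha> *\<^sub>R (adjoint DD 0 + (g0, 0)))"
    and run: "\<forall>\<omega>\<in>space M. primal_dual_run \<alpha> R DD dd Q
                (\<lambda>k. G k \<omega>) (\<lambda>k. X k \<omega>) (\<lambda>k. Xbar k \<omega>) (\<lambda>k. \<Lambda> k \<omega>)"
    and c_ranges: "c1 \<ge> 0" "c2 \<ge> 0" "c4 \<ge> 0" "0 < c3" "c3 \<le> 1"
    and unbiased: "\<forall>k\<ge>1. AE \<omega> in M. vec_cond_exp M (H k) (G k) \<omega> = gradient F (X k \<omega>)"
    and second_moment: "\<forall>k\<ge>1. AE \<omega> in M.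
          nn_cond_exp M (H k) (\<lambda>\<omega>. ennreal ((norm (G k \<omega> - gradient F Xs))\<^sup>2)) \<omega>
            \<le> ennreal (2 * c1 * bregman F (X k \<omega>) Xs + c2 * \<sigma>sq k \<omega>)"
    and \<sigma>_rec: "\<forall>k\<ge>1. AE \<omega> in M.
          nn_cond_exp M (H k) (\<lambda>\<omega>. ennreal (\<sigma>sq (Suc k) \<omega>)) \<omega>
            \<le> ennreal ((1 - c3) * \<sigma>sq k \<omega> + 2 * c4 * bregman F (X k \<omega>) Xs)"
    and \<kappa>_eq: "\<kappa> = c2 / c3"
    and K_pos: "K \<ge> 1"
    and XK_eq: "XK = (\<lambda>\<omega>. (1 / real K) *\<^sub>R (\<Sum>k<K. X (Suc k) \<omega>))"
    and XtK_eq: "XtK = (\<lambda>\<omega>. (1 / real K) *\<^sub>R (\<Sum>k<K. Xbar (Suc k) \<omega>))"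
    and \<alpha>_pos: "0 < \<alpha>"
    and \<alpha>_upper: "ereal \<alpha> < 1 / ereal (2 * (c1 + \<kappa> * c4))"
    and J_pd: "pos_def J"
  shows "(\<lambda>\<omega>. ereal (bregman F (XK \<omega>) Xs)
             + bregman_sub R (- gradient F Xs - adjoint DD \<Lambda>s) (XtK \<omega>) Xs) \<in> borel_measurable M
    \<and> (\<integral>\<^sup>+ \<omega>. e2ennreal (ereal (bregman F (XK \<omega>) Xs)
             + bregman_sub R (- gradient F Xs - adjoint DD \<Lambda>s) (XtK \<omega>) Xs) \<partial>M)
      \<le> ennreal (((norm (Xbar0 - (\<alpha> *\<^sub>R adjoint DD \<Lambda>s + Xs)))\<^sup>2
                   + weighted_norm_sq (\<lambda>v. \<alpha> *\<^sub>R J v) \<Lambda>s + \<kappa> * \<alpha>\<^sup>2 * s1) / (\<alpha> * real K))"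
proof -
  interpret prob_space M by (rule prob)
  have \<kappa>_nonneg: "\<kappa> \<ge> 0" using c_ranges by (simp add: \<kappa>_eq)
  have \<alpha>_le: "2 * \<alpha> * (c1 + \<kappa> * c4) \<le> 1"
  \<comment> \<open>If the sum is 0, the extended quotient is infinite and leaves the step size
    unrestricted; the product form is then trivial.\<close>
  proof (cases "c1 + \<kappa> * c4 = 0")
    case False
    then have "c1 + \<kappa> * c4 > 0" using c_ranges \<kappa>_nonneg by (simp add: order_less_le)
    then show ?thesis using \<alpha>_upper by (simp add: one_ereal_def field_simps)
  qed simp
  interpret S: stochastic_primal_dual F R DD dd Q L \<alpha> Xs \<Lambda>s M H G X Xbar \<Lambda> \<sigma>sq c1 c2 c3 c4 \<kappa> s1 X0 "(g0, 0)"
  proof (intro stochastic_primal_dual.intro primal_dual.intro stochastic_primal_dual_axioms.intro)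
    show "convex_on UNIV F" unfolding F_eq by (rule lift_F_convex[OF f_convex])
    show "GDERIV F x :> gradient F x" for x
      unfolding F_eq using f_diff by (simp add: lift_F_gradient lift_F_GDERIV)
    show "L-lipschitz_on UNIV (gradient F)"
      unfolding F_eq using f_smooth f_diff by (intro lift_F_smooth) auto
    show "proper_closed_convex R" unfolding R_eq by (rule lift_R_pcc[OF r_pcc])
    show "linear DD" unfolding DD_eq by (rule lift_D_linear)
    show "pos_def (\<lambda>v. Q v - \<alpha> *\<^sub>R DD (adjoint DD v))" using J_pd unfolding J_eq .
    have [measurable]: "g k \<in> borel_measurable (H (Suc k))" for k using g_adapted by blast
    show "G k \<in> borel_measurable (H (Suc k))" for k
      using G_eq by simp
    show "\<sigma>sq (Suc k) \<in> borel_measurable (H (Suc k))" for k using \<sigma>_adapted by simp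
    show "\<sigma>sq (Suc k) \<omega> \<ge> 0" if "\<omega> \<in> space M" for k \<omega> using \<sigma>_nonneg that by simp
    show "\<sigma>sq (Suc 0) \<omega> = s1" if "\<omega> \<in> space M" for \<omega> using \<sigma>_init that by simp
    show "subalgebra M (H k)" for k using subalg by blast
    show "X 0 \<omega> = X0" if "\<omega> \<in> space M" for \<omega> using X_init that by blast
    show "G 0 \<omega> = (g0, 0)" if "\<omega> \<in> space M" for \<omega> using G_eq g_init that by simp
    show "primal_dual_run \<alpha> R DD dd Q (\<lambda>k. G k \<omega>) (\<lambda>k. X k \<omega>) (\<lambda>k. Xbar k \<omega>) (\<lambda>k. \<Lambda> k \<omega>)"
      if "\<omega> \<in> space M" for \<omega> using run that by blast
    show "AE \<omega> in M. vec_cond_exp M (H (Suc k)) (G (Suc k)) \<omega> = gradient F (X (Suc k) \<omega>)" for k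
      by (rule unbiased[rule_format]) simp
    show "AE \<omega> in M.
        nn_cond_exp M (H (Suc k)) (\<lambda>\<omega>. ennreal ((norm (G (Suc k) \<omega> - gradient F Xs))\<^sup>2)) \<omega>
          \<le> ennreal (2 * c1 * bregman F (X (Suc k) \<omega>) Xs + c2 * \<sigma>sq (Suc k) \<omega>)" for k
      by (rule second_moment[rule_format]) simp
    show "AE \<omega> in M.
        nn_cond_exp M (H (Suc k)) (\<lambda>\<omega>. ennreal (\<sigma>sq (Suc (Suc k)) \<omega>)) \<omega>
          \<le> ennreal ((1 - c3) * \<sigma>sq (Suc k) \<omega> + 2 * c4 * bregman F (X (Suc k) \<omega>) Xs)" for k
      by (rule \<sigma>_rec[rule_format]) simp
  qed (fact Q_sa \<alpha>_pos saddle prob filt c_ranges \<kappa>_eq \<alpha>_le)+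
  have gap: "ereal (bregman F (XK \<omega>) Xs)
      + bregman_sub R (- gradient F Xs - adjoint DD \<Lambda>s) (XtK \<omega>) Xs = S.gap K \<omega>" for \<omega>
    unfolding S.gap_def XK_eq XtK_eq S.\<theta>s_def ..
  have J: "S.J = J" unfolding J_eq S.J_def[abs_def] ..
  \<comment> \<open>The run starts with multiplier 0 from fixed \<open>X0\<close> and
    \<open>g0\<close>, so its first proximal point is the same in every outcome.\<close>
  have "Xbar 0 \<omega> = Xbar0" if "\<omega> \<in> space M" for \<omega>
    using S.Xbar_eq[OF that, of 0] S.\<Lambda>_0[OF that] X_init that G_eq g_init by (simp add: Xbar0_eq)
  then show ?thesis
    unfolding gap using S.gap_measurable S.expected_gap[OF K_pos] by (simp add: J)
qed

end
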